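(* Let $n,k\in\mathbb{N}$, $U\subset\mathbb{R}^{n+k}$ open, $t_1<t_2$ real, $(V_t)_{t\in[t_1,t_2]}$ a family in $\mathbf{V}_n(U)$, $\mathscr{B}:\mathbf{V}_n(U)\times C_c^2(U)\times\{f:U\to\mathbb{R}^{n+k}\}\to[-\infty,\infty)$ a Brakke variation, and $u_t:U\to\mathbb{R}^{n+k}$ for $t\in[t_1,t_2]$. Suppose that at least one of the following holds: (a) $\sup_{t\in[t_1,t_2]}\|u_t\|_{L^\infty((K,\|V_t\|),\mathbb{R}^{n+k})}<\infty$ for all $K\subset\subset U$; (b) $\sup_{t\in[t_1,t_2]}\|u_t\|_{L^2((K,\|V_t\|),\mathbb{R}^{n+k})}<\infty$ for all $K\subset\subset U$. Then (B1) implies (B2), where: (B1) For all $s\in[t_1,t_2]$ and all $\phi\in C_c^2(U,\mathbb{R}^+)$: $\ \overline{\partial}_t\|V_t\|(\phi)|_{t=s}\le\mathscr{B}(V_s,\phi,u_s)$. (B2) For all $s\in[t_1,t_2]$ and all $\phi\in C^1([t_1,t_2],C_c^2(U,\mathbb{R}^+))$: $\ \overline{\partial}_t(\|V_t\|(\phi_t))|_{t=s}\le\mathscr{B}(V_s,\phi_s,u_s)+\|V_s\|(\partial_t\phi_t|_{t=s})$.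
   Context: Notation. $\mathbb{N}=\{1,2,\dots\}$, $\mathbb{R}^+=[0,\infty)$. $\mathbf{G}(n+k,n)$ is the space of $n$-dimensional linear subspaces $S$ of $\mathbb{R}^{n+k}$; $S_\natural$ is the orthogonal projection onto $S$ (also regarded as a matrix), $S^\perp$ the orthogonal complement and $S^\perp_\natural$ the orthogonal projection onto it. For square matrices $A\cdot B=\mathrm{trace}(A^TB)$. $\mathbf{G}_n(U)=U\times\mathbf{G}(n+k,n)$; $\mathbf{V}_n(U)$ is the set of Radon measures on $\mathbf{G}_n(U)$ (varifolds). For $V\in\mathbf{V}_n(U)$, $\|V\|$ is the Radon measure on $U$ with $\|V\|(A)=V(\{(x,S):x\in A\})$, and $\|V\|(\phi)=\int\phi\,d\|V\|$. $K\subset\subset U$ means the closure of $K$ is a compact subset of $U$. $C_c^2(U,\mathbb{R}^+)$ denotes the nonnegative $C^2$ functions with compact support in $U$. $\phi\in C^1([t_1,t_2],C_c^2(U,\mathbb{R}^+))$ means: $\phi_t\in C_c^2(U,\mathbb{R}^+)$ for all $t$, all $\phi_t$ have support in a common compact subset of $U$, and $t\mapsto\phi_t$ is continuously differentiable with respect to the $C^2$-norm; $\partial_t\phi_t|_{t=s}$ is its derivative. For $f:I\to\mathbb{R}$ on an interval $I$ and $s\in I$: $\overline{\partial}_tf(t)|_{t=s}=\limsup_{t\to s,\,t\in I}\frac{f(t)-f(s)}{t-s}\in[-\infty,\infty]$. Mean curvature. For $V\in\mathbf{V}_n(U)$ and $\Omega\subset U$ open, $\mathbf{H}\in L^1_{\mathrm{loc}}((\Omega,\|V\|),\mathbb{R}^{n+k})$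 is the generalised mean curvature vector of $V$ in $\Omega$ if $\int D\Psi(x)\cdot S_\natural\,dV(x,S)=-\int\Psi\cdot\mathbf{H}\,d\|V\|$ for all $\Psi\in C_c^1(\Omega,\mathbb{R}^{n+k})$. Brakke variation. $\mathscr{B}$ is called a Brakke variation if for all $V\in\mathbf{V}_n(U)$, $\phi\in C_c^2(U,\mathbb{R}^+)$, $f:U\to\mathbb{R}^{n+k}$: if $V$ has a generalised mean curvature vector $\mathbf{H}$ in $\{\phi>0\}$ and $f,\mathbf{H}$ are square integrable on $\{\phi>0\}$ with respect to $\|V\|$, then $$\mathscr{B}(V,\phi,f)\le\int_{\mathbf{G}_n(U)}\big(S^\perp_\natural D\phi(x)-\phi(x)\mathbf{H}(x)\big)\cdot\big(\mathbf{H}(x)+S^\perp_\natural f(x)\big)\,dV(x,S),$$ and otherwise $\mathscr{B}(V,\phi,f)=-\infty$. *)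

theory Defs
  imports "HOL-Analysis.Analysis" "HOL-Probability.Essential_Supremum"
begin

text \<open>
  The ambient space $R^{n+k}$ is \<open>real ^ 'd\<close> with \<open>CARD('d) = n + k\<close>.
\<close>

section \<open>The Grassmannian\<close>

definition grassmannian :: "nat \<Rightarrow> (real ^ 'd::finite) set set"
  where "grassmannian n = {S. subspace S \<and> dim S = n}"

definition proj :: "(real ^ 'd::finite) set \<Rightarrow> real ^ 'd \<Rightarrow> real ^ 'd"
  where "proj S x = (THE y. y \<in> S \<and> (\<forall>z\<in>S. orthogonal (x - y) z))"

definition proj_matrix :: "(real ^ 'd::finite) set \<Rightarrow> real ^ 'd ^ 'd"
  where "proj_matrix S = matrix (proj S)"

definition matrix_dot :: "real ^ 'd ^ 'd::finite \<Rightarrow> real ^ 'd ^ 'd \<Rightarrow> real"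
  where "matrix_dot A B = trace (transpose A ** B)"

text \<open>
  Subspaces are topologised through their orthogonal projections, i.e. by the metric
  given by the distance of the projection matrices.
\<close>

definition grassmannian_topology :: "nat \<Rightarrow> (real ^ 'd::finite) set topology"
  where "grassmannian_topology n = pullback_topology (grassmannian n) proj_matrix euclidean"

definition bundle_topology ::
    "nat \<Rightarrow> (real ^ 'd::finite) set \<Rightarrow> ((real ^ 'd) \<times> (real ^ 'd) set) topology"
  where "bundle_topology n U = prod_topology (top_of_set U) (grassmannian_topology n)"


section \<open>Varifolds\<close>

text \<open>
  Radon measures are carried by the Borel sigma algebra. Measurability and integrability of
  functions that are not given as continuous ones will always refer to the \<^const>\<open>completion\<close>.
\<close>

definition radon_measure :: "'a topology \<Rightarrow> 'a measure \<Rightarrow> bool"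
  where "radon_measure X M \<longleftrightarrow>
    space M = topspace X \<and>
    sets M = sigma_sets (topspace X) {A. openin X A} \<and>
    (\<forall>K. compactin X K \<longrightarrow> emeasure M K < \<infinity>) \<and>
    (\<forall>A\<in>sets M. emeasure M A = (SUP K\<in>{K. compactin X K \<and> K \<subseteq> A}. emeasure M K))"

definition varifolds ::
    "nat \<Rightarrow> (real ^ 'd::finite) set \<Rightarrow> ((real ^ 'd) \<times> (real ^ 'd) set) measure set"
  where "varifolds n U = {V. radon_measure (bundle_topology n U) V}"

definition weight ::
    "(real ^ 'd::finite) set \<Rightarrow> ((real ^ 'd) \<times> (real ^ 'd) set) measure \<Rightarrow> (real ^ 'd) measure"
  where "weight U V = distr V (restrict_space borel U) fst"


section \<open>Test functions\<close>

text \<open>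
  Compactly supported functions on \<open>U\<close> are represented by their extension by zero.
\<close>

definition jacobian :: "(real ^ 'd::finite \<Rightarrow> real ^ 'd) \<Rightarrow> real ^ 'd \<Rightarrow> real ^ 'd ^ 'd"
  where "jacobian \<Psi> x = matrix (frechet_derivative \<Psi> (at x))"

definition gradient :: "(real ^ 'd::finite \<Rightarrow> real) \<Rightarrow> real ^ 'd \<Rightarrow> real ^ 'd"
  where "gradient \<phi> x = (\<chi> i. frechet_derivative \<phi> (at x) (axis i 1))"

definition hessian :: "(real ^ 'd::finite \<Rightarrow> real) \<Rightarrow> real ^ 'd \<Rightarrow> real ^ 'd ^ 'd"
  where "hessian \<phi> = jacobian (gradient \<phi>)"

definition C1_field :: "(real ^ 'd::finite \<Rightarrow> real ^ 'd) \<Rightarrow> bool"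
  where "C1_field \<Psi> \<longleftrightarrow> (\<forall>x. \<Psi> differentiable (at x)) \<and> continuous_on UNIV (jacobian \<Psi>)"

definition C2_fun :: "(real ^ 'd::finite \<Rightarrow> real) \<Rightarrow> bool"
  where "C2_fun \<phi> \<longleftrightarrow> (\<forall>x. \<phi> differentiable (at x)) \<and> C1_field (gradient \<phi>)"

definition support :: "('a::topological_space \<Rightarrow> 'b::zero) \<Rightarrow> 'a set"
  where "support f = closure {x. f x \<noteq> 0}"

definition C1c_fields :: "(real ^ 'd::finite) set \<Rightarrow> (real ^ 'd \<Rightarrow> real ^ 'd) set"
  where "C1c_fields U = {\<Psi>. C1_field \<Psi> \<and> compact (support \<Psi>) \<and> support \<Psi> \<subseteq> U}"

definition C2c :: "(real ^ 'd::finite) set \<Rightarrow> (real ^ 'd \<Rightarrow> real) set"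
  where "C2c U = {\<phi>. C2_fun \<phi> \<and> compact (support \<phi>) \<and> support \<phi> \<subseteq> U}"

definition C2c_nonneg :: "(real ^ 'd::finite) set \<Rightarrow> (real ^ 'd \<Rightarrow> real) set"
  where "C2c_nonneg U = {\<phi> \<in> C2c U. \<forall>x. 0 \<le> \<phi> x}"

text \<open>
  The suprema are suprema of bounded sets for \<open>\<phi> \<in> C2c U\<close>, the only case in which
  the norm is used.
\<close>

definition C2_norm :: "(real ^ 'd::finite \<Rightarrow> real) \<Rightarrow> real"
  where "C2_norm \<phi> =
    (SUP x. \<bar>\<phi> x\<bar>) + (SUP x. norm (gradient \<phi> x)) + (SUP x. norm (hessian \<phi> x))"

text \<open>
  \<open>C1_curve I U \<phi> \<phi>'\<close>: the family \<open>\<phi>\<close> is in $C^1(I, C_c^2(U, R^+))$, and \<open>\<phi>' s\<close> is its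
  derivative with respect to the $C^2$-norm at \<open>s \<in> I\<close>.
\<close>

definition C1_curve ::
    "real set \<Rightarrow> (real ^ 'd::finite) set \<Rightarrow> (real \<Rightarrow> real ^ 'd \<Rightarrow> real) \<Rightarrow>
      (real \<Rightarrow> real ^ 'd \<Rightarrow> real) \<Rightarrow> bool"
  where "C1_curve I U \<phi> \<phi>' \<longleftrightarrow>
    (\<forall>t\<in>I. \<phi> t \<in> C2c_nonneg U) \<and>
    (\<exists>K. compact K \<and> K \<subseteq> U \<and> (\<forall>t\<in>I. support (\<phi> t) \<subseteq> K)) \<and>
    (\<forall>s\<in>I. \<phi>' s \<in> C2c U) \<and>
    (\<forall>s\<in>I. ((\<lambda>t. C2_norm (\<lambda>x. (\<phi> t x - \<phi> s x) / (t - s) - \<phi>' s x)) \<longlongrightarrow> 0) (at s within I)) \<and>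
    (\<forall>s\<in>I. ((\<lambda>t. C2_norm (\<lambda>x. \<phi>' t x - \<phi>' s x)) \<longlongrightarrow> 0) (at s within I))"


section \<open>Norms with respect to a measure\<close>

definition relatively_compact_in :: "'a::topological_space set \<Rightarrow> 'a set \<Rightarrow> bool"
  where "relatively_compact_in K U \<longleftrightarrow> compact (closure K) \<and> closure K \<subseteq> U"

text \<open>
  Both norms are infinite for functions that are not measurable. The maximum with zero is
  only relevant for null measures, where the essential supremum is \<open>-\<infinity>\<close>.
\<close>

definition Linf_norm :: "'a measure \<Rightarrow> 'a set \<Rightarrow> ('a \<Rightarrow> 'b::euclidean_space) \<Rightarrow> ereal"
  where "Linf_norm \<mu> K f =
    (let M = restrict_space (completion \<mu>) K in
     if f \<in> borel_measurable M then max 0 (esssup M (\<lambda>x. ereal (norm (f x)))) else \<infinity>)"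

definition L2_norm :: "'a measure \<Rightarrow> 'a set \<Rightarrow> ('a \<Rightarrow> 'b::euclidean_space) \<Rightarrow> ereal"
  where "L2_norm \<mu> K f =
    (let M = restrict_space (completion \<mu>) K in
     if f \<in> borel_measurable M \<and> integrable M (\<lambda>x. (norm (f x))\<^sup>2)
     then ereal (sqrt (\<integral>x. (norm (f x))\<^sup>2 \<partial>M)) else \<infinity>)"

definition square_integrable_on :: "'a measure \<Rightarrow> 'a set \<Rightarrow> ('a \<Rightarrow> 'b::euclidean_space) \<Rightarrow> bool"
  where "square_integrable_on \<mu> A f \<longleftrightarrow>
    set_borel_measurable (completion \<mu>) A f \<and>
    set_integrable (completion \<mu>) A (\<lambda>x. (norm (f x))\<^sup>2)"


section \<open>Mean curvature and Brakke variations\<close>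

definition generalised_mean_curvature ::
    "(real ^ 'd::finite) set \<Rightarrow> ((real ^ 'd) \<times> (real ^ 'd) set) measure \<Rightarrow> (real ^ 'd) set \<Rightarrow>
      (real ^ 'd \<Rightarrow> real ^ 'd) \<Rightarrow> bool"
  where "generalised_mean_curvature U V \<Omega> H \<longleftrightarrow>
    (\<forall>K. compact K \<and> K \<subseteq> \<Omega> \<longrightarrow> set_integrable (completion (weight U V)) K H) \<and>
    (\<forall>\<Psi>\<in>C1c_fields \<Omega>.
      (\<integral>(x, S). matrix_dot (jacobian \<Psi> x) (proj_matrix S) \<partial>V)
        = - (\<integral>x. \<Psi> x \<bullet> H x \<partial>completion (weight U V)))"

text \<open>
  The mean curvature vector is only determined almost everywhere on \<open>{x. 0 < \<phi> x}\<close>. The integral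
  does not depend on the choice, since \<open>\<phi>\<close> and its gradient vanish outside this set. The elements
  of \<^term>\<open>extensional U\<close> represent the functions defined on \<open>U\<close>.
\<close>

definition brakke_variation ::
    "nat \<Rightarrow> (real ^ 'd::finite) set \<Rightarrow>
      (((real ^ 'd) \<times> (real ^ 'd) set) measure \<Rightarrow> (real ^ 'd \<Rightarrow> real) \<Rightarrow>
        (real ^ 'd \<Rightarrow> real ^ 'd) \<Rightarrow> ereal) \<Rightarrow> bool"
  where "brakke_variation n U B \<longleftrightarrow>
    (\<forall>V\<in>varifolds n U. \<forall>\<phi>\<in>C2c_nonneg U. \<forall>f\<in>extensional U.
      let admissible = (\<lambda>H.
            generalised_mean_curvature U V {x. 0 < \<phi> x} H \<and>
            square_integrable_on (weight U V) {x. 0 < \<phi> x} f \<and>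
            square_integrable_on (weight U V) {x. 0 < \<phi> x} H)
      in (\<forall>H. admissible H \<longrightarrow>
            B V \<phi> f \<le> ereal (\<integral>(x, S).
              (proj (S\<^sup>\<bottom>) (gradient \<phi> x) - \<phi> x *\<^sub>R H x) \<bullet> (H x + proj (S\<^sup>\<bottom>) (f x))
              \<partial>completion V)) \<and>
         ((\<nexists>H. admissible H) \<longrightarrow> B V \<phi> f = -\<infinity>))"

definition upper_derivative :: "real set \<Rightarrow> (real \<Rightarrow> real) \<Rightarrow> real \<Rightarrow> ereal"
  where "upper_derivative I f s = Limsup (at s within I) (\<lambda>t. ereal ((f t - f s) / (t - s)))"

end

theory Submission
  imports Defs
begin

text \<open>
  Write $L_t(\phi) = \int \phi\, d\|V_t\|$ and split the difference quotient of $L_t(\phi_t)$ at \<open>s\<close> as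
  $$ \frac{L_t(\phi_s) - L_s(\phi_s)}{t-s} + L_t\Big(\frac{\phi_t-\phi_s}{t-s}\Big). $$
  The first term, called $q$, is controlled by (B1) for the fixed test function $\phi_s$. The second is
  close to $L_t(\partial_t\phi|_s)$, but $L_t(\partial_t\phi|_s)$ need not converge to
  $L_s(\partial_t\phi|_s)$, because mass may disappear suddenly. What (B1) does give, since Brakke
  variations are less than \<open>\<infinity>\<close>, is semicontinuity with a linear rate: for each nonnegative test
  function $\theta$, $L_t(\theta)$ exceeds $L_s(\theta)$ by at most $C|t-s|$ for $t > s$, and $L_s(\theta)$
  exceeds $L_t(\theta)$ by at most $C|t-s|$ for $t < s$.

  Let $\sigma$ be the sign of $t-s$. As $\phi_t \ge 0$, the function $\sigma\,\partial_t\phi|_s$ is nonnegative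
  where $\phi_s$ vanishes. By compactness, $\theta = \sigma\,\partial_t\phi|_s + \epsilon\eta + M\phi_s$ is
  nonnegative for a cutoff function $\eta$, any $\epsilon > 0$ and some $M$. Semicontinuity for
  $\theta$ bounds $L_t(\partial_t\phi|_s)$ by $L_s(\partial_t\phi|_s)$ up to errors of order
  $|t-s|$ and $\epsilon$, and up to the term $-M|t-s|\,q$. The latter combines with the first term to
  $(1-M|t-s|)\,q$, which has the same upper bound in the limit; if mass disappears where $\phi_s > 0$,
  then $q$ tends to \<open>-\<infinity>\<close> and pays for it. This is \<open>one_sided_quotient_le\<close>.

  The errors of order $\epsilon$ are small only if $L_t(\eta)$ stays bounded as $t \to s$. For $t > s$ this
  is again semicontinuity. For $t < s$ it is a local mass bound (\<open>locally_bounded\<close>), and here the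
  hypothesis on \<open>u\<close> enters. For $\rho = A - |x-y|^2$ and $\phi = (\rho^+)^4$, Young's inequality and
  the first variation identity for the vector field $D\phi$ give
  $\mathscr{B}(V_t,\phi,u_t) \le D \int (\rho^+)^3\, d\|V_t\| + D$ with \<open>D\<close> independent of \<open>t\<close> and of \<open>A\<close>
  (\<open>brakke_variation_bump_uniform_bound\<close>). The convexity term of the first variation is what
  dominates the gradient term $|D\phi|^2/\phi$. If \<open>A\<close> decreases with sufficient speed, then the
  time derivative of $\phi$ absorbs the integral of $(\rho^+)^3$, and the integral of the moving bump grows
  at most linearly in time (\<open>barrier\<close>). This step is itself a case of (B2), for a moving test function,
  but there is no circularity: a growth bound needs difference quotients from the right only.
\<close>

section \<open>Orthogonal projections and the Grassmannian\<close>

lemma proj_eqI: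
  assumes "subspace S" "y \<in> S" "\<And>z. z \<in> S \<Longrightarrow> orthogonal (x - y) z"
  shows "proj S x = y"
  unfolding proj_def
proof (rule the_equality)
  show "y \<in> S \<and> (\<forall>z\<in>S. orthogonal (x - y) z)"
    using assms by auto
next
  fix w assume w: "w \<in> S \<and> (\<forall>z\<in>S. orthogonal (x - w) z)"
  have "w - y \<in> S"
    using w assms subspace_diff by blast
  then have "(x - y) \<bullet> (w - y) = 0" "(x - w) \<bullet> (w - y) = 0"
    using w assms by (auto simp: orthogonal_def)
  then have "(w - y) \<bullet> (w - y) = 0"
    by (simp add: inner_diff_left)
  then show "w = y" by simp
qed

lemma proj_works:
  assumes "subspace S"
  shows "proj S x \<in> S" and "z \<in> S \<Longrightarrow> orthogonal (x - proj S x) z"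
proof -
  obtain y z where yz: "y \<in> span S" "\<And>w. w \<in> span S \<Longrightarrow> orthogonal z w" "x = y + z"
    using orthogonal_subspace_decomp_exists[of S x] by metis
  have S: "span S = S" using assms by (simp add: span_eq_iff)
  have "proj S x = y"
    using assms yz S by (intro proj_eqI) auto
  then show "proj S x \<in> S" "z \<in> S \<Longrightarrow> orthogonal (x - proj S x) z" for z
    using yz S by auto
qed

lemma linear_proj:
  assumes "subspace S"
  shows "linear (proj S)"
proof (rule linearI)
  show "proj S (x + y) = proj S x + proj S y" for x y
    using proj_works(1)[OF assms, of x] proj_works(1)[OF assms, of y] assms
      proj_works(2)[OF assms, of _ x] proj_works(2)[OF assms, of _ y]
    by (intro proj_eqI) (auto simp: subspace_add orthogonal_def inner_diff_left inner_add_left)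
  show "proj S (c *\<^sub>R x) = c *\<^sub>R proj S x" for c x
    using proj_works(1)[OF assms, of x] proj_works(2)[OF assms, of _ x] assms
    by (intro proj_eqI) (auto simp: subspace_scale orthogonal_def inner_diff_left)
qed

lemma proj_inner:
  assumes "subspace S"
  shows "proj S x \<bullet> y = proj S x \<bullet> proj S y"
proof -
  have "orthogonal (y - proj S y) (proj S x)"
    using proj_works[OF assms] by blast
  then show ?thesis
    by (simp add: orthogonal_def inner_diff_left inner_commute[of y] inner_commute[of "proj S y"])
qed

lemma proj_complement:
  assumes "subspace S"
  shows "proj (S\<^sup>\<bottom>) x = x - proj S x"
  using proj_works(1)[OF assms, of x] proj_works(2)[OF assms, of _ x]
  by (intro proj_eqI subspace_orthogonal_comp) (auto simp: orthogonal_comp_def orthogonal_commute)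

lemma norm_proj_le:
  assumes "subspace S"
  shows "norm (proj S x) \<le> norm x"
proof (cases "proj S x = 0")
  case False
  have "norm (proj S x) * norm (proj S x) = proj S x \<bullet> x"
    using proj_inner[OF assms, of x x] by (simp add: norm_eq_sqrt_inner)
  also have "\<dots> \<le> norm (proj S x) * norm x"
    by (rule norm_cauchy_schwarz)
  finally show ?thesis using False by simp
qed simp

lemma proj_matrix_mult:
  assumes "subspace S"
  shows "proj_matrix S *v x = proj S x"
  using linear_proj[OF assms] by (simp add: proj_matrix_def matrix_works)

lemma trace_eq_sum_inner: "trace (A :: real ^ 'd::finite ^ 'd) = (\<Sum>i\<in>UNIV. (A *v axis i 1) \<bullet> axis i 1)"
  by (simp add: trace_def inner_axis matrix_vector_mul_component inner_axis' )

lemma subspace_if_grassmannian: "S \<in> grassmannian n \<Longrightarrow> subspace S"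
  by (simp add: grassmannian_def)

lemma proj_matrix_symmetric:
  assumes "subspace S"
  shows "transpose (proj_matrix S) = proj_matrix S"
proof -
  have "(proj_matrix S *v x) \<bullet> y = x \<bullet> (proj_matrix S *v y)" for x y
    unfolding proj_matrix_mult[OF assms]
    using proj_inner[OF assms, of x y] proj_inner[OF assms, of y x] by (metis inner_commute)
  then have "transpose (proj_matrix S) *v y = proj_matrix S *v y" for y
    by (metis dot_lmul_matrix inner_commute transpose_matrix_vector vector_eq_ldot)
  then show ?thesis by (simp add: matrix_eq)
qed

lemma proj_matrix_idem:
  assumes "subspace S"
  shows "proj_matrix S ** proj_matrix S = proj_matrix S"
proof -
  have "proj S (proj S x) = proj S x" for x
    using proj_works[OF assms, of x] by (intro proj_eqI assms) (auto simp: orthogonal_def)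
  then have "(proj_matrix S ** proj_matrix S) *v x = proj_matrix S *v x" for x
    by (simp add: proj_matrix_mult[OF assms] flip: matrix_vector_mul_assoc)
  then show ?thesis by (simp add: matrix_eq)
qed

text \<open>
  The trace turns the rank condition of the Grassmannian into a closed condition on
  projection matrices, which is what makes the Grassmannian compact.
\<close>
lemma trace_proj_matrix:
  fixes S :: "(real ^ 'd::finite) set"
  assumes "subspace S"
  shows "trace (proj_matrix S) = dim S"
proof -
  obtain B where B: "B \<subseteq> S" "pairwise orthogonal B" "\<And>b. b \<in> B \<Longrightarrow> norm b = 1"
      "independent B" "card B = dim S" "span B = S"
    using orthonormal_basis_subspace[OF assms] by metis
  have fin: "finite B" using B(4) by (simp add: independent_imp_finite)
  have eq: "proj S x = (\<Sum>b\<in>B. (b \<bullet> x) *\<^sub>R b)" for x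
  proof (rule proj_eqI[OF assms])
    show "(\<Sum>b\<in>B. (b \<bullet> x) *\<^sub>R b) \<in> S"
      using B assms by (intro subspace_sum) (auto simp: subspace_scale)
    fix z assume "z \<in> S"
    have "orthogonal (x - (\<Sum>b\<in>B. (b \<bullet> x / (b \<bullet> b)) *\<^sub>R b)) z"
      using Gram_Schmidt_step[OF B(2), of z x] \<open>z \<in> S\<close> B(6) by (simp add: orthogonal_commute)
    moreover have "(\<Sum>b\<in>B. (b \<bullet> x / (b \<bullet> b)) *\<^sub>R b) = (\<Sum>b\<in>B. (b \<bullet> x) *\<^sub>R b)"
      using B(3) by (intro sum.cong) (auto simp: norm_eq_sqrt_inner)
    ultimately show "orthogonal (x - (\<Sum>b\<in>B. (b \<bullet> x) *\<^sub>R b)) z" by simp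
  qed
  have "trace (proj_matrix S) = (\<Sum>i\<in>UNIV. \<Sum>b\<in>B. (b \<bullet> axis i 1) * (b \<bullet> axis i 1))"
    by (simp add: trace_eq_sum_inner proj_matrix_mult[OF assms] eq inner_sum_left)
  also have "\<dots> = (\<Sum>b\<in>B. \<Sum>i\<in>UNIV. (b $ i) * (b $ i))"
    by (subst sum.swap) (simp add: inner_axis)
  also have "\<dots> = (\<Sum>b\<in>B. b \<bullet> b)"
    by (simp add: inner_vec_def)
  also have "\<dots> = (\<Sum>b\<in>B. 1)"
    using B(3) by (intro sum.cong) (auto simp: norm_eq_1)
  finally show ?thesis using B by simp
qed

lemma proj_matrix_image_grassmannian:
  "proj_matrix ` (grassmannian n :: (real ^ 'd::finite) set set)
    = {P. P ** P = P \<and> transpose P = P \<and> trace P = real n}"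
proof (intro equalityI subsetI)
  fix P assume "P \<in> proj_matrix ` (grassmannian n :: (real ^ 'd) set set)"
  then show "P \<in> {P. P ** P = P \<and> transpose P = P \<and> trace P = real n}"
    by (auto simp: grassmannian_def proj_matrix_symmetric proj_matrix_idem trace_proj_matrix)
next
  fix P :: "real ^ 'd ^ 'd" assume "P \<in> {P. P ** P = P \<and> transpose P = P \<and> trace P = real n}"
  then have P: "P ** P = P" "transpose P = P" "trace P = real n" by auto
  define S where "S = range ((*v) P)"
  have S: "subspace S"
    unfolding S_def by (intro linear_subspace_image) auto
  have "proj S x = P *v x" for x
  proof (rule proj_eqI[OF S])
    show "P *v x \<in> S" by (simp add: S_def)
    fix z assume "z \<in> S"
    then obtain w where z: "z = P *v w" by (auto simp: S_def)
    have "(x - P *v x) \<bullet> (P *v w) = (P *v (x - P *v x)) \<bullet> w"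
      using P(2) by (metis dot_lmul_matrix inner_commute transpose_matrix_vector)
    also have "P *v (x - P *v x) = 0"
      using P(1) by (simp add: matrix_vector_mult_diff_distrib matrix_vector_mul_assoc)
    finally show "orthogonal (x - P *v x) z" by (simp add: z orthogonal_def)
  qed
  then have eq: "proj_matrix S = P"
    using S by (simp add: matrix_eq proj_matrix_mult)
  then have "dim S = n"
    using trace_proj_matrix[OF S] P(3) by simp
  with S have "S \<in> grassmannian n" by (simp add: grassmannian_def)
  with eq show "P \<in> proj_matrix ` (grassmannian n :: (real ^ 'd) set set)" by blast
qed

lemma inj_on_proj_matrix: "inj_on proj_matrix (grassmannian n)"
proof (rule inj_onI)
  fix S T :: "(real ^ 'd) set"
  assume ST: "S \<in> grassmannian n" "T \<in> grassmannian n" "proj_matrix S = proj_matrix T"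
  have "range (proj S) = S" if "subspace S" for S :: "(real ^ 'd) set"
  proof -
    have "proj S x = x" if "x \<in> S" for x
      using \<open>x \<in> S\<close> \<open>subspace S\<close> by (intro proj_eqI) (auto simp: orthogonal_def)
    then show ?thesis using proj_works[OF that] by (metis image_subset_iff rangeI subsetI subset_antisym)
  qed
  moreover have "proj S = proj T"
    using ST by (metis ext proj_matrix_mult subspace_if_grassmannian)
  ultimately show "S = T" using ST subspace_if_grassmannian by metis
qed

lemma compact_proj_matrix_image:
  "compact (proj_matrix ` (grassmannian n :: (real ^ 'd::finite) set set))"
proof -
  let ?G = "{P :: real ^ 'd ^ 'd. P ** P = P \<and> transpose P = P \<and> trace P = real n}"
  have "closed ?G"
    unfolding matrix_matrix_mult_def transpose_def trace_def
    by (intro closed_Collect_conj closed_Collect_eq continuous_intros)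
  moreover have "norm P \<le> (\<Sum>i\<in>(UNIV::'d set). 1)" if "P \<in> proj_matrix ` grassmannian n" for P :: "real ^ 'd ^ 'd"
  proof -
    obtain S where S: "subspace S" "P = proj_matrix S"
      using \<open>P \<in> _\<close> by (auto simp: grassmannian_def)
    have "norm (P $ i) \<le> 1" for i
    proof -
      have "P $ i = transpose P *v axis i 1"
        by (simp add: matrix_vector_mul_component vec_eq_iff matrix_vector_mult_basis column_transpose row_def)
      also have "\<dots> = proj S (axis i 1)"
        using S by (simp add: proj_matrix_symmetric proj_matrix_mult)
      finally show ?thesis using norm_proj_le[OF S(1), of "axis i 1"] by simp
    qed
    then have "(\<Sum>i\<in>UNIV. norm (P $ i)) \<le> (\<Sum>i\<in>(UNIV::'d set). 1)"
      by (intro sum_mono)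
    moreover have "norm P \<le> (\<Sum>i\<in>UNIV. norm (P $ i))"
      by (simp add: norm_vec_def L2_set_le_sum)
    ultimately show ?thesis by linarith
  qed
  then have "bounded ?G"
    unfolding bounded_iff proj_matrix_image_grassmannian[symmetric] by blast
  ultimately show ?thesis
    by (simp add: proj_matrix_image_grassmannian compact_eq_bounded_closed)
qed

text \<open>
  The topology is pulled back along \<^const>\<open>proj_matrix\<close>, so the inverse of
  \<^const>\<open>proj_matrix\<close> is continuous on the compact set of projection matrices of trace \<open>n\<close>.
\<close>
lemma compactin_grassmannian:
  "compactin (grassmannian_topology n) (grassmannian n :: (real ^ 'd::finite) set set)"
proof -
  let ?G = "grassmannian n :: (real ^ 'd) set set"
  let ?g = "inv_into ?G proj_matrix"
  have "continuous_map (top_of_set (proj_matrix ` ?G)) (grassmannian_topology n) ?g"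
    unfolding grassmannian_topology_def
  proof (rule continuous_map_pullback')
    have "continuous_map (top_of_set (proj_matrix ` ?G)) euclidean id"
      by simp
    then show "continuous_map (top_of_set (proj_matrix ` ?G)) euclidean (proj_matrix \<circ> ?g)"
      by (rule continuous_map_eq) (auto simp: f_inv_into_f)
    show "topspace (top_of_set (proj_matrix ` ?G)) \<subseteq> ?g -` ?G"
      by (auto intro: inv_into_into)
  qed
  then have "compactin (grassmannian_topology n) (?g ` (proj_matrix ` ?G))"
    using compact_proj_matrix_image
    by (intro image_compactin[of "top_of_set (proj_matrix ` ?G)"]) (auto simp: compactin_subtopology)
  then show ?thesis by (simp add: inj_on_proj_matrix)
qed

lemma topspace_bundle: "topspace (bundle_topology n U) = U \<times> grassmannian n"
  by (simp add: bundle_topology_def grassmannian_topology_def topspace_pullback_topology)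

lemma continuous_map_bundle_fst: "continuous_map (bundle_topology n U) euclidean fst"
  unfolding bundle_topology_def
  by (metis continuous_map_fst continuous_map_in_subtopology)

lemma continuous_map_bundle_proj_matrix:
  "continuous_map (bundle_topology n U) euclidean (\<lambda>z. proj_matrix (snd z))"
proof -
  have "continuous_map (grassmannian_topology n) euclidean (id \<circ> proj_matrix)"
    unfolding grassmannian_topology_def by (intro continuous_map_pullback) simp
  then show ?thesis
    unfolding bundle_topology_def
    using continuous_map_compose[OF continuous_map_snd] by (fastforce simp: o_def)
qed

section \<open>Varifolds and their weight measures\<close>

lemma space_varifold: "V \<in> varifolds n U \<Longrightarrow> space V = U \<times> grassmannian n"
  by (simp add: varifolds_def radon_measure_def topspace_bundle)

lemma continuous_map_measurable_varifold:
  fixes f :: "_ \<Rightarrow> 'b::topological_space"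
  assumes "V \<in> varifolds n U" "continuous_map (bundle_topology n U) euclidean f"
  shows "f \<in> borel_measurable V"
proof (rule borel_measurableI)
  fix T :: "'b set" assume "open T"
  then have "openin (bundle_topology n U) {z \<in> topspace (bundle_topology n U). f z \<in> T}"
    using assms(2) by (auto simp: continuous_map_def)
  moreover have "f -` T \<inter> space V = {z \<in> topspace (bundle_topology n U). f z \<in> T}"
    using assms(1) by (auto simp: varifolds_def radon_measure_def)
  moreover have "sets V = sigma_sets (topspace (bundle_topology n U)) {A. openin (bundle_topology n U) A}"
    using assms(1) by (simp add: varifolds_def radon_measure_def)
  ultimately show "f -` T \<inter> space V \<in> sets V"
    by (metis mem_Collect_eq sigma_sets.Basic)
qed

lemmas measurable_varifold_fst = continuous_map_measurable_varifold[OF _ continuous_map_bundle_fst]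
lemmas measurable_varifold_proj_matrix =
  continuous_map_measurable_varifold[OF _ continuous_map_bundle_proj_matrix]

lemma measurable_fst_restrict:
  assumes "V \<in> varifolds n U"
  shows "fst \<in> V \<rightarrow>\<^sub>M restrict_space borel U"
  using measurable_varifold_fst[OF assms] space_varifold[OF assms]
  by (intro measurable_restrict_space2) auto

lemma space_weight [simp]: "space (weight U V) = U"
  by (simp add: weight_def space_restrict_space)

lemma borel_measurable_weight:
  "f \<in> borel_measurable borel \<Longrightarrow> f \<in> borel_measurable (weight U V)"
  by (simp add: weight_def measurable_restrict_space1)

lemma sets_weight: "A \<in> sets borel \<Longrightarrow> A \<subseteq> U \<Longrightarrow> A \<in> sets (weight U V)"
  by (auto simp: weight_def sets_restrict_space)

text \<open>
  A Radon measure on the bundle is only known to be finite on compact sets, and the preimage of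
  \<open>K\<close> is \<open>K \<times> grassmannian n\<close>; this is where compactness of the Grassmannian is needed.
\<close>
lemma emeasure_weight_compact:
  assumes V: "V \<in> varifolds n U" and K: "compact K" "K \<subseteq> U"
  shows "emeasure (weight U V) K < \<infinity>"
proof -
  have "compactin (bundle_topology n U) (K \<times> grassmannian n)"
    unfolding bundle_topology_def using compactin_grassmannian K
    by (auto simp: compactin_Times compactin_subtopology)
  then have "emeasure V (K \<times> grassmannian n) < \<infinity>"
    using V by (auto simp: varifolds_def radon_measure_def)
  moreover have "emeasure (weight U V) K = emeasure V (fst -` K \<inter> space V)"
    unfolding weight_def using K measurable_fst_restrict[OF V]
    by (intro emeasure_distr) (auto simp: sets_restrict_space borel_compact)
  moreover have "fst -` K \<inter> space V = K \<times> grassmannian n"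
    using K by (auto simp: space_varifold[OF V])
  ultimately show ?thesis by simp
qed

text \<open>
  The mean curvature and the transport field are measurable only for the completed weight,
  while Brakke's integral lives on the completed varifold. Completion commutes with pushing
  forward along the bundle projection, which allows passing between the two.
\<close>
lemma measurable_completion_fst:
  assumes V: "V \<in> varifolds n U"
  shows "fst \<in> completion V \<rightarrow>\<^sub>M completion (weight U V)"
    and "completion (weight U V) = distr (completion V) (completion (weight U V)) fst"
proof -

  let ?W = "weight U V"
  have W: "sets ?W = sets (restrict_space borel U)" by (simp add: weight_def)
  have f: "fst \<in> V \<rightarrow>\<^sub>M ?W"
    using measurable_fst_restrict[OF V] by (simp add: measurable_cong_sets[OF refl W])
  have f': "fst \<in> completion V \<rightarrow>\<^sub>M ?W"
    using f by (rule measurable_completion)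
  have d: "distr (completion V) ?W fst = ?W"
    using distr_completion[OF f] distr_cong[OF refl W, of V fst fst] by (simp add: weight_def)
  show "fst \<in> completion V \<rightarrow>\<^sub>M completion ?W"
    using f' d by (intro completion.measurable_completion2) auto
  show "completion ?W = distr (completion V) (completion ?W) fst"
    using completion.completion_distr_eq[OF f'] d by simp
qed

lemma
  fixes h :: "_ \<Rightarrow> real"
  assumes V: "V \<in> varifolds n U" and h: "h \<in> borel_measurable (completion (weight U V))"
  shows integral_completion_weight:
      "(\<integral>x. h x \<partial>completion (weight U V)) = (\<integral>z. h (fst z) \<partial>completion V)"
    and integrable_completion_weight:
      "integrable (completion (weight U V)) h \<longleftrightarrow> integrable (completion V) (\<lambda>z. h (fst z))"
proof -
  show "(\<integral>x. h x \<partial>completion (weight U V)) = (\<integral>z. h (fst z) \<partial>completion V)"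
    using integral_distr[OF measurable_completion_fst(1)[OF V] h] measurable_completion_fst(2)[OF V]
    by simp
  show "integrable (completion (weight U V)) h \<longleftrightarrow> integrable (completion V) (\<lambda>z. h (fst z))"
    using integrable_distr_eq[OF measurable_completion_fst(1)[OF V] h] measurable_completion_fst(2)[OF V]
    by simp
qed

lemma integrable_weight:
  fixes f :: "_ \<Rightarrow> real"
  assumes V: "V \<in> varifolds n U" and K: "compact K" "K \<subseteq> U"
    and f: "f \<in> borel_measurable borel" "\<And>x. \<bar>f x\<bar> \<le> C" "\<And>x. x \<notin> K \<Longrightarrow> f x = 0"
  shows "integrable (weight U V) f"
proof (rule Bochner_Integration.integrable_bound)
  show "integrable (weight U V) (\<lambda>x. C * indicator K x :: real)"
    using K emeasure_weight_compact[OF V K] by (auto intro!: integrable_real_mult_indicator sets_weight borel_compact)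
  show "f \<in> borel_measurable (weight U V)"
    using f by (intro borel_measurable_weight)
  show "AE x in weight U V. norm (f x) \<le> norm (C * indicator K x :: real)"
    using f(2,3) by (auto simp: indicator_def intro!: AE_I2) (metis abs_ge_self order_trans)
qed

section \<open>Calculus of test functions\<close>

lemma has_derivative_gradient:
  fixes \<phi> :: "real ^ 'd::finite \<Rightarrow> real"
  assumes "\<phi> differentiable (at x)"
  shows "(\<phi> has_derivative (\<lambda>v. gradient \<phi> x \<bullet> v)) (at x)"
proof -
  let ?D = "frechet_derivative \<phi> (at x)"
  have D: "(\<phi> has_derivative ?D) (at x)"
    using assms by (simp add: frechet_derivative_works)
  then have "linear ?D" by (rule has_derivative_linear)
  have "?D v = gradient \<phi> x \<bullet> v" for v
  proof -
    have "?D v = ?D (\<Sum>i\<in>UNIV. v $ i *\<^sub>R axis i 1)"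
      by (simp add: basis_expansion flip: scalar_mult_eq_scaleR)
    also have "\<dots> = (\<Sum>i\<in>UNIV. v $ i * ?D (axis i 1))"
      using \<open>linear ?D\<close> by (simp add: linear_sum linear_cmul)
    finally show ?thesis by (simp add: gradient_def inner_vec_def mult.commute)
  qed
  then have "?D = (\<lambda>v. gradient \<phi> x \<bullet> v)" by blast
  with D show ?thesis by simp
qed

lemma gradient_eqI:
  assumes "(\<phi> has_derivative (\<lambda>v. g \<bullet> v)) (at x)"
  shows "gradient \<phi> x = g"
  by (simp add: gradient_def vec_eq_iff inner_axis flip: frechet_derivative_at[OF assms])

lemma jacobian_eqI:
  assumes "(\<Psi> has_derivative D) (at x)"
  shows "jacobian \<Psi> x = matrix D"
  using frechet_derivative_at[OF assms] by (simp add: jacobian_def)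

lemma C1_fieldI:
  assumes "\<And>x. (\<Psi> has_derivative D x) (at x)" and "\<And>v. continuous_on UNIV (\<lambda>x. D x v)"
  shows "C1_field \<Psi>"
proof -
  have "jacobian \<Psi> = (\<lambda>x. matrix (D x))"
    using assms(1) jacobian_eqI by blast
  moreover have "continuous_on UNIV (\<lambda>x. matrix (D x))"
    unfolding matrix_def using assms(2) by (intro continuous_intros)
  ultimately show ?thesis
    using assms(1) by (auto simp: C1_field_def differentiable_def)
qed

lemma C1_fieldE:
  assumes "C1_field \<Psi>"
  obtains D where "\<And>x. (\<Psi> has_derivative D x) (at x)" "\<And>v. continuous_on UNIV (\<lambda>x. D x v)"
proof
  show D: "(\<Psi> has_derivative frechet_derivative \<Psi> (at x)) (at x)" for x
    using assms by (simp add: C1_field_def frechet_derivative_works)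
  have "frechet_derivative \<Psi> (at x) v = jacobian \<Psi> x *v v" for x v
    using has_derivative_linear[OF D] by (simp add: jacobian_def matrix_works)
  then show "continuous_on UNIV (\<lambda>x. frechet_derivative \<Psi> (at x) v)" for v
    using assms unfolding matrix_vector_mult_def C1_field_def
    by (simp, intro continuous_intros, auto intro: continuous_on_component)
qed

lemma C2_funI:
  assumes "\<And>x. (\<phi> has_derivative (\<lambda>v. g x \<bullet> v)) (at x)" and "C1_field g"
  shows "C2_fun \<phi>"
proof -
  have "gradient \<phi> = g"
    using assms(1) gradient_eqI by blast
  then show ?thesis
    using assms by (auto simp: C2_fun_def differentiable_def)
qed

lemma closed_support [simp]: "closed (support f)"
  by (simp add: support_def)

lemma in_support: "f x \<noteq> 0 \<Longrightarrow> x \<in> support f"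
  unfolding support_def by (rule subsetD[OF closure_subset]) simp

lemma support_subsetI: "closed K \<Longrightarrow> (\<And>x. x \<notin> K \<Longrightarrow> f x = 0) \<Longrightarrow> support f \<subseteq> K"
  unfolding support_def by (intro closure_minimal) auto

lemma C2cI:
  assumes "C2_fun \<phi>" "compact K" "K \<subseteq> U" "\<And>x. x \<notin> K \<Longrightarrow> \<phi> x = 0"
  shows "\<phi> \<in> C2c U"
proof -
  have "support \<phi> \<subseteq> K"
    using assms by (intro support_subsetI) (auto intro: compact_imp_closed)
  moreover from this have "compact (support \<phi>)"
    using compact_Int_closed[OF assms(2) closed_support[of \<phi>]] by (simp add: Int_absorb1)
  ultimately show ?thesis using assms by (auto simp: C2c_def)
qed

lemma C2c_add_scale:
  assumes "\<phi> \<in> C2c U" "\<psi> \<in> C2c U"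
  shows "(\<lambda>x. a * \<phi> x + b * \<psi> x) \<in> C2c U"
proof (rule C2cI)
  show "compact (support \<phi> \<union> support \<psi>)" "support \<phi> \<union> support \<psi> \<subseteq> U"
    using assms by (auto simp: C2c_def)
  show "a * \<phi> x + b * \<psi> x = 0" if "x \<notin> support \<phi> \<union> support \<psi>" for x
  proof -
    have "\<phi> x = 0" "\<psi> x = 0" using that in_support[of \<phi> x] in_support[of \<psi> x] by blast+
    then show ?thesis by simp
  qed
  have C: "C2_fun \<phi>" "C2_fun \<psi>" using assms by (auto simp: C2c_def)
  obtain D E where D: "\<And>x. (gradient \<phi> has_derivative D x) (at x)" "\<And>v. continuous_on UNIV (\<lambda>x. D x v)"
    and E: "\<And>x. (gradient \<psi> has_derivative E x) (at x)" "\<And>v. continuous_on UNIV (\<lambda>x. E x v)"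
    using C unfolding C2_fun_def by (metis C1_fieldE)
  show "C2_fun (\<lambda>x. a * \<phi> x + b * \<psi> x)"
  proof (rule C2_funI)
    show "((\<lambda>x. a * \<phi> x + b * \<psi> x) has_derivative (\<lambda>v. (a *\<^sub>R gradient \<phi> x + b *\<^sub>R gradient \<psi> x) \<bullet> v)) (at x)" for x
      using C unfolding C2_fun_def
      by (auto intro!: derivative_eq_intros has_derivative_gradient simp: inner_add_left)
    show "C1_field (\<lambda>x. a *\<^sub>R gradient \<phi> x + b *\<^sub>R gradient \<psi> x)"
    proof (rule C1_fieldI)
      show "((\<lambda>x. a *\<^sub>R gradient \<phi> x + b *\<^sub>R gradient \<psi> x) has_derivative (\<lambda>v. a *\<^sub>R D x v + b *\<^sub>R E x v)) (at x)" for x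
        by (intro derivative_intros D E)
      show "continuous_on UNIV (\<lambda>x. a *\<^sub>R D x v + b *\<^sub>R E x v)" for v
        by (intro continuous_intros D E)
    qed
  qed
qed

lemma C2c_zero: "(\<lambda>x. 0) \<in> C2c U"
proof (rule C2cI[where K = "{}"])
  show "C2_fun (\<lambda>x::real ^ 'd. 0)"
  proof (rule C2_funI)
    show "((\<lambda>x::real ^ 'd. 0::real) has_derivative (\<lambda>v. 0 \<bullet> v)) (at x)" for x by simp
    show "C1_field (\<lambda>x::real ^ 'd. 0)"
      by (rule C1_fieldI[where D = "\<lambda>x v. 0"]) auto
  qed
qed auto

lemma C2c_sum:
  assumes "\<And>i. i \<in> F \<Longrightarrow> \<phi> i \<in> C2c U"
  shows "(\<lambda>x. \<Sum>i\<in>F. \<phi> i x) \<in> C2c U"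
proof (cases "finite F")
  case True
  then show ?thesis using assms
  proof (induction F rule: finite_induct)
    case empty then show ?case using C2c_zero by simp
  next
    case (insert i F)
    then have "(\<lambda>x. 1 * \<phi> i x + 1 * (\<Sum>j\<in>F. \<phi> j x)) \<in> C2c U"
      by (intro C2c_add_scale) auto
    then show ?case using insert by simp
  qed
qed (use C2c_zero in simp)

lemma C2c_scale: "\<phi> \<in> C2c U \<Longrightarrow> (\<lambda>x. a * \<phi> x) \<in> C2c U"
  using C2c_add_scale[of \<phi> U "\<phi>" a 0] by simp

lemma C2c_continuous: "\<phi> \<in> C2c U \<Longrightarrow> continuous_on A \<phi>"
  by (auto simp: C2c_def C2_fun_def intro!: differentiable_imp_continuous_on
      simp: differentiable_on_def differentiable_at_withinI)

lemma bounded_if_zero_outside_compact: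
  fixes f :: "'a::topological_space \<Rightarrow> 'b::real_normed_vector"
  assumes "continuous_on UNIV f" "compact K" "\<And>x. x \<notin> K \<Longrightarrow> f x = 0"
  shows "\<exists>C\<ge>0. \<forall>x. norm (f x) \<le> C"
proof -
  have "compact (f ` K)"
    using assms by (intro compact_continuous_image continuous_on_subset[OF assms(1)]) auto
  then obtain C where "C > 0" "\<forall>y\<in>f ` K. norm y \<le> C"
    using bounded_pos compact_imp_bounded by blast
  then show ?thesis
    using assms(3) by (metis image_eqI less_imp_le norm_zero)
qed

lemma C2c_bounded:
  assumes "\<phi> \<in> C2c U"
  shows "\<exists>C\<ge>0. \<forall>x. \<bar>\<phi> x\<bar> \<le> C"
  using bounded_if_zero_outside_compact[OF C2c_continuous[OF assms, of UNIV], of "support \<phi>"] assms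
    in_support[of \<phi>] by (auto simp: C2c_def)

lemma has_derivative_zero_outside_support:
  assumes "x \<notin> support f"
  shows "(f has_derivative (\<lambda>v. 0)) (at x)"
proof (rule has_derivative_transform_within_open)
  show "((\<lambda>x. 0) has_derivative (\<lambda>v. 0)) (at x)" by simp
  show "open (- support f)" "x \<in> - support f" using assms by auto
  show "0 = f y" if "y \<in> - support f" for y
    using that in_support[of f y] by auto
qed

text \<open>
  The suprema over the gradient and the Hessian are suprema of bounded sets, hence nonnegative.
\<close>
lemma abs_le_C2_norm:
  assumes h: "h \<in> C2c U"
  shows "\<bar>h x\<bar> \<le> C2_norm h"
proof -
  have K: "compact (support h)" and C2: "C2_fun h" using h by (auto simp: C2c_def)
  have g0: "gradient h x = 0" if "x \<notin> support h" for x
    using has_derivative_zero_outside_support[OF that] by (intro gradient_eqI) simp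
  then have sg: "support (gradient h) \<subseteq> support h"
    by (intro support_subsetI) auto
  have H0: "hessian h x = 0" if "x \<notin> support h" for x
  proof -
    have "x \<notin> support (gradient h)" using that sg by auto
    then have "hessian h x = matrix (\<lambda>v. 0)"
      unfolding hessian_def by (intro jacobian_eqI has_derivative_zero_outside_support)
    then show ?thesis by (simp add: matrix_def vec_eq_iff)
  qed
  have cg: "continuous_on UNIV (gradient h)" and cH: "continuous_on UNIV (hessian h)"
    using C2 by (auto simp: C2_fun_def C1_field_def hessian_def
        intro!: differentiable_imp_continuous_on simp: differentiable_on_def differentiable_at_withinI)
  obtain C1 where C1: "\<forall>x. \<bar>h x\<bar> \<le> C1" using C2c_bounded[OF h] by blast
  obtain C2 where C2: "\<forall>x. norm (gradient h x) \<le> C2"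
    using bounded_if_zero_outside_compact[OF cg K g0] by blast
  obtain C3 where C3: "\<forall>x. norm (hessian h x) \<le> C3"
    using bounded_if_zero_outside_compact[OF cH K H0] by blast
  have "bdd_above (range (\<lambda>x. \<bar>h x\<bar>))" "bdd_above (range (\<lambda>x. norm (gradient h x)))"
      "bdd_above (range (\<lambda>x. norm (hessian h x)))"
    using C1 C2 C3 by (auto simp: bdd_above_def)
  then have "\<bar>h x\<bar> \<le> (SUP x. \<bar>h x\<bar>)" "norm (gradient h x) \<le> (SUP x. norm (gradient h x))"
      "norm (hessian h x) \<le> (SUP x. norm (hessian h x))"
    by (auto intro: cSUP_upper)
  then show ?thesis
    unfolding C2_norm_def using norm_ge_zero[of "gradient h x"] norm_ge_zero[of "hessian h x"] by linarith
qed

section \<open>Radial bumps\<close>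

text \<open>
  For \<open>p \<ge> 3\<close> these are $C^2$. The \<open>p\<close>-th and the \<open>(p - 1)\<close>-st power are related by
  differentiation in the parameter \<open>A\<close>, so a bump and its time derivative along a moving \<open>A\<close>
  are both test functions if \<open>p = 4\<close>.
\<close>
definition bump :: "nat \<Rightarrow> 'a::real_inner \<Rightarrow> real \<Rightarrow> 'a \<Rightarrow> real"
  where "bump p y A x = (max 0 (A - (x - y) \<bullet> (x - y))) ^ p"

lemma has_real_derivative_pos_part_power:
  "((\<lambda>r::real. (max 0 r) ^ (p + 2)) has_real_derivative (real p + 2) * (max 0 r) ^ (p + 1)) (at r)"
proof (cases r "0::real" rule: linorder_cases)
  case less
  have "((\<lambda>r::real. 0) has_real_derivative 0) (at r)" by simp
  then have "((\<lambda>r::real. (max 0 r) ^ (p + 2)) has_real_derivative 0) (at r)"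
    by (rule has_field_derivative_transform_within_open[where S = "{..<0}"]) (use less in auto)
  then show ?thesis using less by simp
next
  case greater
  have "((\<lambda>r::real. r ^ (p + 2)) has_real_derivative real (p + 2) * r ^ (p + 2 - 1)) (at r)"
    using DERIV_pow[of "p + 2" r] by simp
  then have "((\<lambda>r::real. (max 0 r) ^ (p + 2)) has_real_derivative real (p + 2) * r ^ (p + 2 - 1)) (at r)"
    by (rule has_field_derivative_transform_within_open[where S = "{0<..}"]) (use greater in auto)
  then show ?thesis using greater by (simp add: algebra_simps)
next
  case equal
  have "((\<lambda>h::real. (max 0 h) ^ (p + 1)) \<longlongrightarrow> (max 0 0) ^ (p + 1)) (at 0)"
    by (intro tendsto_intros)
  moreover have "\<forall>\<^sub>F h in at 0. (max 0 h) ^ (p + 1) = ((max 0 (0 + h)) ^ (p + 2) - (max 0 0) ^ (p + 2)) / (h::real)"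
    by (rule eventually_at_filter[THEN iffD2]) (auto simp: max_def)
  ultimately have "((\<lambda>h::real. ((max 0 (0 + h)) ^ (p + 2) - (max 0 0) ^ (p + 2)) / h) \<longlongrightarrow> 0) (at 0)"
    by (force intro: Lim_transform_eventually)
  then show ?thesis using equal by (simp add: DERIV_def)
qed

lemma has_derivative_bump:
  "(bump (p + 2) y A has_derivative
      (\<lambda>v. ((- 2 * (real p + 2) * bump (p + 1) y A x) *\<^sub>R (x - y)) \<bullet> v)) (at x)"
proof -
  have "((\<lambda>x. A - (x - y) \<bullet> (x - y)) has_derivative (\<lambda>v. - 2 * ((x - y) \<bullet> v))) (at x)"
    by (auto intro!: derivative_eq_intros simp: inner_commute)
  from has_derivative_compose[OF this has_field_derivative_imp_has_derivative[OF
        has_real_derivative_pos_part_power[of p "A - (x - y) \<bullet> (x - y)"]]]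
  show ?thesis by (simp add: bump_def[abs_def] algebra_simps)
qed

lemma has_derivative_bump_gradient:
  "(bump (p + 3) y A has_derivative
      (\<lambda>v. ((- 2 * (real p + 3) * bump (p + 2) y A x) *\<^sub>R (x - y)) \<bullet> v)) (at x)"
proof -
  have "p + 1 + 2 = p + 3" "p + 1 + 1 = p + 2" "real (p + 1) + 2 = real p + 3" by auto
  with has_derivative_bump[of "p + 1" y A x] show ?thesis by (simp only:)
qed

lemma continuous_on_bump [continuous_intros]: "continuous_on T (bump p y A)"
  unfolding bump_def[abs_def] by (intro continuous_intros)

lemma bump_nonneg [simp]: "0 \<le> bump p y A x"
  by (simp add: bump_def)

lemma bump_eq_power: "bump p y A x = bump 1 y A x ^ p"
  by (simp add: bump_def)

lemma bump_eq_0_iff: "0 < p \<Longrightarrow> bump p y A x = 0 \<longleftrightarrow> A \<le> (x - y) \<bullet> (x - y)"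
  by (auto simp: bump_def max_def)

lemma has_derivative_gradient_bump:
  "((\<lambda>x. (- 2 * (real p + 3) * bump (p + 2) y A x) *\<^sub>R (x - y)) has_derivative
     (\<lambda>v. (- 2 * (real p + 3) * bump (p + 2) y A x) *\<^sub>R v
        + (4 * (real p + 3) * (real p + 2) * bump (p + 1) y A x * ((x - y) \<bullet> v)) *\<^sub>R (x - y))) (at x)"
  by (rule derivative_eq_intros has_derivative_bump refl)+ (simp add: fun_eq_iff algebra_simps)

lemma gradient_bump:
  "gradient (bump (p + 3) y A) = (\<lambda>x. (- 2 * (real p + 3) * bump (p + 2) y A x) *\<^sub>R (x - y))"
  using gradient_eqI[OF has_derivative_bump_gradient] by blast

lemma C1_field_gradient_bump: "C1_field (gradient (bump (p + 3) y A :: real ^ 'd::finite \<Rightarrow> real))"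
  unfolding gradient_bump
  by (rule C1_fieldI[OF has_derivative_gradient_bump]) (intro continuous_intros)

lemma C2_fun_bump: "C2_fun (bump (p + 3) y A :: real ^ 'd::finite \<Rightarrow> real)"
proof (rule C2_funI)
  show "C1_field (gradient (bump (p + 3) y A :: real ^ 'd \<Rightarrow> real))"
    by (rule C1_field_gradient_bump)
  show "(bump (p + 3) y A has_derivative (\<lambda>v. gradient (bump (p + 3) y A) x \<bullet> v)) (at x)" for x :: "real ^ 'd"
    unfolding gradient_bump by (rule has_derivative_bump_gradient)
qed

lemma bump_zero_outside:
  assumes "A \<le> R\<^sup>2" "0 \<le> R" "0 < p" "x \<notin> cball y R"
  shows "bump p y A x = 0"
proof -
  have "R \<le> norm (x - y)" using assms by (simp add: dist_norm norm_minus_commute)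
  then have "R\<^sup>2 \<le> (x - y) \<bullet> (x - y)"
    using assms by (simp add: dot_square_norm power_mono)
  then show ?thesis using assms by (simp add: bump_eq_0_iff)
qed

lemma bump_C2c:
  fixes y :: "real ^ 'd::finite"
  assumes "A \<le> R\<^sup>2" "0 \<le> R" "cball y R \<subseteq> U"
  shows "bump (p + 3) y A \<in> C2c U"
  using assms by (intro C2cI[OF C2_fun_bump, of "cball y R"] bump_zero_outside) auto

lemma bump_C2c_nonneg:
  fixes y :: "real ^ 'd::finite"
  assumes "A \<le> R\<^sup>2" "0 \<le> R" "cball y R \<subseteq> U"
  shows "bump (p + 3) y A \<in> C2c_nonneg U"
  using bump_C2c[OF assms] by (simp add: C2c_nonneg_def)

lemma exists_bump_cover:
  fixes K :: "(real ^ 'd::finite) set"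
  assumes K: "compact K" and r: "\<And>y. y \<in> K \<Longrightarrow> 0 < r y"
  shows "\<exists>F c. finite F \<and> F \<subseteq> K \<and> 0 \<le> c \<and> (\<forall>x\<in>K. 1 \<le> c * (\<Sum>y\<in>F. bump 4 y (r y) x))"
proof -
  have "\<exists>F\<subseteq>K. finite F \<and> K \<subseteq> (\<Union>y\<in>F. {x. (x - y) \<bullet> (x - y) < r y})"
  proof (rule compactE_image[OF K])
    show "open {x. (x - y) \<bullet> (x - y) < r y}" for y :: "real ^ 'd"
      by (intro open_Collect_less continuous_intros)
    show "K \<subseteq> (\<Union>y\<in>K. {x. (x - y) \<bullet> (x - y) < r y})"
      using r by auto
  qed blast
  then obtain F where F: "F \<subseteq> K" "finite F" and cov: "K \<subseteq> (\<Union>y\<in>F. {x. (x - y) \<bullet> (x - y) < r y})"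
    by blast
  let ?f = "\<lambda>x. \<Sum>y\<in>F. bump 4 y (r y) x"
  have pos: "0 < ?f x" if "x \<in> K" for x
  proof -
    obtain y where y: "y \<in> F" "(x - y) \<bullet> (x - y) < r y" using cov \<open>x \<in> K\<close> by blast
    then have "0 < bump 4 y (r y) x" by (simp add: bump_def)
    then show ?thesis using y F by (intro sum_pos2[of F y]) auto
  qed
  show ?thesis
  proof (cases "K = {}")
    case True then show ?thesis using F by (intro exI[of _ F] exI[of _ 0]) auto
  next
    case False
    have "continuous_on K ?f" by (intro continuous_intros)
    then obtain x0 where x0: "x0 \<in> K" "\<And>x. x \<in> K \<Longrightarrow> ?f x0 \<le> ?f x"
      using continuous_attains_inf[OF K False] by blast
    have "1 \<le> 1 / ?f x0 * ?f x" if "x \<in> K" for x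
      using x0(2)[OF that] pos[OF x0(1)] by (simp add: field_simps)
    then show ?thesis
      using F pos[OF x0(1)] by (intro exI[of _ F] exI[of _ "1 / ?f x0"]) auto
  qed
qed

lemma exists_cutoff:
  fixes U :: "(real ^ 'd::finite) set"
  assumes "open U" "compact K" "K \<subseteq> U"
  shows "\<exists>\<eta>\<in>C2c_nonneg U. \<forall>x\<in>K. 1 \<le> \<eta> x"
proof -
  have "\<exists>r>0. cball y r \<subseteq> U" if "y \<in> K" for y
    using that assms open_contains_cball by blast
  then obtain r where r: "\<And>y. y \<in> K \<Longrightarrow> 0 < r y \<and> cball y (r y) \<subseteq> U" by metis
  obtain F c where F: "finite F" "F \<subseteq> K" "0 \<le> c" "\<forall>x\<in>K. 1 \<le> c * (\<Sum>y\<in>F. bump 4 y ((r y)\<^sup>2) x)"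
    using exists_bump_cover[OF assms(2), of "\<lambda>y. (r y)\<^sup>2"] r by (auto simp: less_imp_neq[symmetric])
  have "bump (1 + 3) y ((r y)\<^sup>2) \<in> C2c U" if "y \<in> F" for y
    using that r[of y] F by (intro bump_C2c[of _ "r y"]) auto
  then have "(\<lambda>x. c * (\<Sum>y\<in>F. bump 4 y ((r y)\<^sup>2) x)) \<in> C2c U"
    by (intro C2c_scale C2c_sum) simp
  then show ?thesis
    using F by (intro bexI[of _ "\<lambda>x. c * (\<Sum>y\<in>F. bump 4 y ((r y)\<^sup>2) x)"])
      (auto simp: C2c_nonneg_def intro!: mult_nonneg_nonneg sum_nonneg)
qed

text \<open>
  On the compact set where \<open>\<psi> \<le> - \<epsilon>\<close> the function \<open>\<phi>\<close> has no zero, hence a positive minimum,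
  and a multiple of \<open>\<phi>\<close> outweighs \<open>\<psi>\<close> there; elsewhere \<open>\<epsilon> * \<eta>\<close> suffices.
\<close>
lemma nonneg_after_adding_multiple:
  fixes \<phi> \<psi> \<eta> :: "'a::metric_space \<Rightarrow> real"
  assumes cont: "continuous_on UNIV \<phi>" "continuous_on UNIV \<psi>"
    and K: "compact K" "\<And>x. x \<notin> K \<Longrightarrow> \<psi> x = 0" "\<And>x. x \<in> K \<Longrightarrow> 1 \<le> \<eta> x"
    and nonneg: "\<And>x. 0 \<le> \<phi> x" "\<And>x. 0 \<le> \<eta> x"
    and zero: "\<And>x. \<phi> x = 0 \<Longrightarrow> 0 \<le> \<psi> x"
    and \<epsilon>: "0 < \<epsilon>"
  shows "\<exists>M\<ge>0. \<forall>x. 0 \<le> \<psi> x + \<epsilon> * \<eta> x + M * \<phi> x"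
proof -
  define L where "L = K \<inter> {x. \<psi> x \<le> - \<epsilon>}"
  have "closed {x. \<psi> x \<le> - \<epsilon>}"
    using cont by (intro closed_Collect_le continuous_intros)
  then have L: "compact L" unfolding L_def using K(1) by (rule compact_Int_closed[rotated])
  have out: "0 \<le> \<psi> x + \<epsilon> * \<eta> x" if "x \<notin> L" for x
  proof (cases "x \<in> K")
    case True
    then have "- \<epsilon> < \<psi> x" "\<epsilon> * 1 \<le> \<epsilon> * \<eta> x"
      using that K(3) \<epsilon> by (auto simp: L_def)
    then show ?thesis by linarith
  qed (use K nonneg \<epsilon> in auto)
  show ?thesis
  proof (cases "L = {}")
    case True then show ?thesis using out by (intro exI[of _ 0]) auto
  next
    case False
    obtain a where a: "a \<in> L" "\<And>x. x \<in> L \<Longrightarrow> \<phi> a \<le> \<phi> x"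
      using continuous_attains_inf[OF L False continuous_on_subset[OF cont(1)]] by auto
    obtain b where b: "b \<in> L" "\<And>x. x \<in> L \<Longrightarrow> \<psi> b \<le> \<psi> x"
      using continuous_attains_inf[OF L False continuous_on_subset[OF cont(2)]] by auto
    have "\<phi> a \<noteq> 0" using zero[of a] a(1) \<epsilon> by (auto simp: L_def)
    then have pos: "0 < \<phi> a" using nonneg(1)[of a] by linarith
    let ?M = "- \<psi> b / \<phi> a"
    have M: "0 \<le> ?M" using b(1) \<epsilon> pos by (auto simp: L_def field_simps)
    have "0 \<le> \<psi> x + \<epsilon> * \<eta> x + ?M * \<phi> x" for x
    proof (cases "x \<in> L")
      case True
      have "?M * \<phi> a \<le> ?M * \<phi> x" using a(2)[OF True] M by (intro mult_left_mono)
      moreover have "?M * \<phi> a = - \<psi> b" using pos by simp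
      moreover have "0 \<le> \<epsilon> * \<eta> x" using \<epsilon> nonneg by simp
      ultimately show ?thesis using b(2)[OF True] by linarith
    next
      case False
      have "0 \<le> ?M * \<phi> x" using M nonneg by (intro mult_nonneg_nonneg)
      then show ?thesis using out[OF False] by linarith
    qed
    then show ?thesis using M by blast
  qed
qed

section \<open>The Brakke variation of a radial bump\<close>

lemma matrix_dot_matrix:
  "matrix_dot (matrix D) (matrix E) = (\<Sum>i\<in>UNIV. D (axis i 1) \<bullet> E (axis i 1))"
  by (simp add: matrix_dot_def trace_def matrix_matrix_mult_def transpose_def matrix_def inner_vec_def)

text \<open>
  The divergence along \<open>S\<close> of the gradient of $\rho^4$, \<open>\<rho>\<close> being the positive part of $A - |x-y|^2$. The convexity of
  the power function contributes the term $48 \rho^2 |S_\natural(x-y)|^2$, which has the good sign in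
  the first variation.
\<close>
lemma matrix_dot_jacobian_bump:
  assumes S: "S \<in> grassmannian n"
  shows "matrix_dot (jacobian (gradient (bump 4 y A)) x) (proj_matrix S)
    = 48 * bump 2 y A x * (norm (proj_matrix S *v (x - y)))\<^sup>2 - 8 * real n * bump 3 y A x"
proof -
  let ?z = "x - y" and ?e = "\<lambda>i. axis i (1::real)"
  have sub: "subspace S" using S by (rule subspace_if_grassmannian)
  let ?D = "\<lambda>v. (- 8 * bump 3 y A x) *\<^sub>R v + (48 * bump 2 y A x * (?z \<bullet> v)) *\<^sub>R ?z"
  have "jacobian (gradient (bump 4 y A)) x = matrix ?D"
    using has_derivative_gradient_bump[of 1 y A x] gradient_bump[of 1 y A]
    by (intro jacobian_eqI) (simp add: numeral_eq_Suc)
  then have "matrix_dot (jacobian (gradient (bump 4 y A)) x) (proj_matrix S)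
      = (\<Sum>i\<in>UNIV. ?D (?e i) \<bullet> proj S (?e i))"
    by (simp only: proj_matrix_def matrix_dot_matrix)
  also have "\<dots> = (- 8 * bump 3 y A x) * (\<Sum>i\<in>UNIV. proj S (?e i) \<bullet> ?e i)
      + (48 * bump 2 y A x) * (\<Sum>i\<in>UNIV. ?z $ i * (?z \<bullet> proj S (?e i)))"
    by (simp add: inner_add_left sum.distrib sum_distrib_left sum_subtractf inner_axis sum_negf
        inner_commute[of "axis _ _"] algebra_simps)
  also have "(\<Sum>i\<in>UNIV. proj S (?e i) \<bullet> ?e i) = real n"
    using trace_proj_matrix[OF sub] S by (simp add: trace_eq_sum_inner proj_matrix_mult[OF sub] grassmannian_def)
  also have "(\<Sum>i\<in>UNIV. ?z $ i * (?z \<bullet> proj S (?e i))) = (\<Sum>i\<in>UNIV. ?z $ i * proj S ?z $ i)"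
  proof (intro sum.cong refl arg_cong2[where f = "(*)"])
    fix i
    have "?z \<bullet> proj S (?e i) = proj S ?z \<bullet> ?e i"
      using proj_inner[OF sub, of ?z "?e i"] proj_inner[OF sub, of "?e i" ?z] by (metis inner_commute)
    then show "?z \<bullet> proj S (?e i) = proj S ?z $ i" by (simp add: inner_axis)
  qed
  also have "\<dots> = proj S ?z \<bullet> ?z"
    by (simp add: inner_vec_def mult.commute)
  also have "\<dots> = (norm (proj S ?z))\<^sup>2"
    using proj_inner[OF sub] by (metis power2_norm_eq_inner)
  finally show ?thesis by (simp add: proj_matrix_mult[OF sub])
qed

text \<open>
  Here \<open>g\<close> is the gradient of $\phi = r^4$. Nothing forces \<open>h\<close> to be normal to \<open>S\<close>, so the tangential
  part of \<open>g\<close> has to be split off. Young's inequality bounds it by $\phi|h|^2/2$ plus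
  $32 r^2 |S_\natural z|^2$, and bounds the product of \<open>h\<close> and \<open>f\<close> by
  $\phi|h|^2/2 + \phi|f|^2/2$. The two halves are exactly paid by the term $-\phi|h|^2$. The
  constant 48 leaves room: it is the one that the first variation of a bump provides.
\<close>
lemma brakke_integrand_le:
  fixes z h f :: "real ^ 'd::finite"
  assumes S: "subspace S" and r: "0 \<le> r" and g: "g = (- 8 * r ^ 3) *\<^sub>R z"
  shows "(proj (S\<^sup>\<bottom>) g - r ^ 4 *\<^sub>R h) \<bullet> (h + proj (S\<^sup>\<bottom>) f)
    \<le> g \<bullet> h + 48 * r\<^sup>2 * (norm (proj S z))\<^sup>2 + 8 * r ^ 3 * norm z * norm f + r ^ 4 * (norm f)\<^sup>2 / 2"
proof -
  let ?P = "proj S" and ?Q = "proj (S\<^sup>\<bottom>)"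
  have Q: "?Q g = g - ?P g" by (rule proj_complement[OF S])
  have Pg: "?P g = (- 8 * r ^ 3) *\<^sub>R ?P z"
    unfolding g by (rule linear_cmul[OF linear_proj[OF S]])
  have "(?Q g - r ^ 4 *\<^sub>R h) \<bullet> (h + ?Q f)
      = g \<bullet> h + 8 * r ^ 3 * (?P z \<bullet> h) + ?Q g \<bullet> ?Q f - r ^ 4 * (h \<bullet> h) - r ^ 4 * (h \<bullet> ?Q f)"
    unfolding Q by (simp add: Pg inner_diff_left inner_add_right algebra_simps)
  moreover have "8 * r ^ 3 * (?P z \<bullet> h) \<le> r ^ 4 * (h \<bullet> h) / 2 + 32 * r\<^sup>2 * (norm (?P z))\<^sup>2"
  proof -
    have "8 * r ^ 3 * (?P z \<bullet> h) \<le> 8 * r ^ 3 * (norm (?P z) * norm h)"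
      using r norm_cauchy_schwarz by (intro mult_left_mono) auto
    also have "\<dots> \<le> r ^ 4 * (norm h)\<^sup>2 / 2 + 32 * r\<^sup>2 * (norm (?P z))\<^sup>2"
      using zero_le_power2[of "r\<^sup>2 * norm h - 8 * r * norm (?P z)"]
      by (simp add: power2_eq_square power3_eq_cube power4_eq_xxxx algebra_simps)
    finally show ?thesis by (simp add: power2_norm_eq_inner)
  qed
  moreover have "?Q g \<bullet> ?Q f \<le> 8 * r ^ 3 * norm z * norm f"
  proof -
    have "?Q g \<bullet> ?Q f \<le> norm (?Q g) * norm (?Q f)" by (rule norm_cauchy_schwarz)
    also have "\<dots> \<le> norm g * norm f"
      by (intro mult_mono norm_proj_le subspace_orthogonal_comp) auto
    finally show ?thesis using r by (simp add: g)
  qed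
  moreover have "- (r ^ 4 * (h \<bullet> ?Q f)) \<le> r ^ 4 * (h \<bullet> h) / 2 + r ^ 4 * (norm f)\<^sup>2 / 2"
  proof -
    have "- (h \<bullet> ?Q f) \<le> norm h * norm (?Q f)"
      using norm_cauchy_schwarz[of "- h" "?Q f"] by simp
    also have "\<dots> \<le> norm h * norm f"
      by (intro mult_left_mono norm_proj_le subspace_orthogonal_comp) auto
    also have "\<dots> \<le> ((norm h)\<^sup>2 + (norm f)\<^sup>2) / 2"
      using zero_le_power2[of "norm h - norm f"] by (simp add: power2_eq_square algebra_simps)
    finally have "r ^ 4 * (- (h \<bullet> ?Q f)) \<le> r ^ 4 * (((norm h)\<^sup>2 + (norm f)\<^sup>2) / 2)"
      using r by (intro mult_left_mono) auto
    then show ?thesis by (simp add: power2_norm_eq_inner algebra_simps add_divide_distrib)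
  qed
  moreover have "32 * r\<^sup>2 * (norm (?P z))\<^sup>2 \<le> 48 * r\<^sup>2 * (norm (?P z))\<^sup>2"
    by (simp add: mult_right_mono)
  ultimately show ?thesis by linarith
qed

lemma bump_mono: "A \<le> A' \<Longrightarrow> bump p y A x \<le> bump p y A' x"
  unfolding bump_def by (intro power_mono) auto

lemma bump_le:
  assumes "A \<le> R\<^sup>2"
  shows "bump p y A x \<le> R ^ (2 * p)"
proof -
  have "max 0 (A - (x - y) \<bullet> (x - y)) \<le> R\<^sup>2"
    using assms inner_ge_zero[of "x - y"] by (simp del: inner_ge_zero)
  then show ?thesis unfolding bump_def by (simp add: power_mono power_mult)
qed

lemma borel_measurable_bump [measurable]: "bump p y A \<in> borel_measurable (borel :: (_::euclidean_space) measure)"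
  by (intro borel_measurable_continuous_onI continuous_intros)

lemma bump_times_norm_le:
  assumes "A \<le> R\<^sup>2" "0 \<le> R" "0 < p"
  shows "bump p y A x * norm (x - y) \<le> bump p y A x * R"
proof (cases "x \<in> cball y R")
  case True
  then show ?thesis by (intro mult_left_mono) (auto simp: dist_norm norm_minus_commute)
qed (simp add: bump_zero_outside[OF assms])


lemma gradient_bump_4: "gradient (bump 4 y A) = (\<lambda>x. (- 8 * bump 3 y A x) *\<^sub>R (x - y))"
  using gradient_bump[of 1 y A] by (simp add: numeral_eq_Suc)

text \<open>
  The gradient of a bump is not compactly supported in the open ball where the bump is positive;
  the gradients of slightly smaller bumps are.
\<close>
lemma gradient_bump_in_C1c_fields:
  fixes y :: "real ^ 'd::finite"
  assumes "A' < A"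
  shows "gradient (bump 4 y A') \<in> C1c_fields {x. 0 < bump 4 y A x}"
proof -
  let ?K = "{x. (x - y) \<bullet> (x - y) \<le> A'}"
  have "closed ?K" by (intro closed_Collect_le continuous_intros)
  moreover have "bounded ?K"
    unfolding bounded_iff
  proof (intro exI ballI)
    fix x assume "x \<in> ?K"
    then have "norm (x - y) \<le> sqrt A'" by (simp add: norm_eq_sqrt_inner)
    then show "norm x \<le> norm y + sqrt A'" using norm_triangle_sub[of x y] by linarith
  qed
  ultimately have K: "compact ?K" by (simp add: compact_eq_bounded_closed)
  have "gradient (bump 4 y A') x = 0" if "x \<notin> ?K" for x
    using that by (simp add: gradient_bump_4 bump_eq_0_iff)
  with \<open>closed ?K\<close> have sub: "support (gradient (bump 4 y A')) \<subseteq> ?K"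
    by (intro support_subsetI)
  then have "compact (support (gradient (bump 4 y A')))"
    using compact_Int_closed[OF K closed_support[of "gradient (bump 4 y A')"]] by (simp add: Int_absorb1)
  moreover have "?K \<subseteq> {x. 0 < bump 4 y A x}"
    using assms by (auto simp: bump_def)
  moreover have "C1_field (gradient (bump 4 y A'))"
    using C1_field_gradient_bump[of 1 y A'] by (simp add: numeral_eq_Suc)
  ultimately show ?thesis using sub by (auto simp: C1c_fields_def)
qed

lemma integrable_varifold_weight:
  fixes h :: "_ \<Rightarrow> real"
  assumes "V \<in> varifolds n U" "integrable (weight U V) h"
  shows "integrable V (\<lambda>z. h (fst z))"
  using assms(2) unfolding weight_def by (rule integrable_distr[OF measurable_fst_restrict[OF assms(1)]])

lemma measurable_norm_proj_matrix:
  assumes "V \<in> varifolds n U"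
  shows "(\<lambda>z. (norm (proj_matrix (snd z) *v (fst z - y)))\<^sup>2) \<in> borel_measurable V"
proof (rule borel_measurable_continuous_Pair[where H = "\<lambda>P x. (norm (P *v (x - y)))\<^sup>2"])
  show "(\<lambda>z. proj_matrix (snd z)) \<in> borel_measurable V" "fst \<in> borel_measurable V"
    using assms by (rule measurable_varifold_proj_matrix measurable_varifold_fst)+
  show "continuous_on UNIV (\<lambda>p. (norm (fst p *v (snd p - y)))\<^sup>2)"
    unfolding matrix_vector_mult_def by (intro continuous_intros)
qed

lemma integrable_bump:
  fixes y :: "real ^ 'd::finite"
  assumes V: "V \<in> varifolds n U" and R: "A \<le> R\<^sup>2" "0 \<le> R" "cball y R \<subseteq> U" and p: "0 < p"
  shows "integrable (weight U V) (bump p y A)"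
proof (rule integrable_weight[OF V, of "cball y R" _ "R ^ (2 * p)"])
  show "\<bar>bump p y A x\<bar> \<le> R ^ (2 * p)" for x
    using bump_le[OF R(1), of p y x] by simp
qed (use R p bump_zero_outside in auto)

text \<open>
  Square integrability is only known where the bump is positive, and \<open>H\<close> need not be
  measurable elsewhere; the weight \<^term>\<open>bump 3 y A\<close> vanishes there.
\<close>
lemma square_integrable_bump_integrable:
  fixes H :: "real ^ 'd::finite \<Rightarrow> real ^ 'd"
  assumes V: "V \<in> varifolds n U" and R: "A \<le> R\<^sup>2" "0 \<le> R" "cball y R \<subseteq> U"
    and H: "square_integrable_on (weight U V) {x. 0 < bump 4 y A x} H"
  shows "integrable (completion (weight U V)) (\<lambda>x. bump 3 y A x * (norm (H x))\<^sup>2)"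
    and "integrable (completion (weight U V)) (\<lambda>x. bump 3 y A x * norm (x - y) * norm (H x))"
proof -
  let ?W = "completion (weight U V)" and ?I = "\<lambda>x. indicator {x. 0 < bump 4 y A x} x :: real"
  \<comment> \<open>unlike \<open>H\<close>, this field is measurable on the whole space\<close>
  define H' where "H' = (\<lambda>x. ?I x *\<^sub>R H x)"
  have m: "H' \<in> borel_measurable ?W" and i: "integrable ?W (\<lambda>x. ?I x *\<^sub>R (norm (H x))\<^sup>2)"
    using H by (simp_all add: square_integrable_on_def set_borel_measurable_def set_integrable_def H'_def)
  have mb: "bump 3 y A \<in> borel_measurable ?W" "(\<lambda>x. norm (x - y)) \<in> borel_measurable ?W"
    by (intro measurable_completion borel_measurable_weight; measurable)+
  have z: "bump 3 y A x = 0" if "\<not> 0 < bump 4 y A x" for x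
    using that by (auto simp: bump_def max_def)
  have eq: "bump 3 y A x * (norm (H x))\<^sup>2 = bump 3 y A x * (norm (H' x))\<^sup>2"
      "bump 3 y A x * norm (x - y) * norm (H x) = bump 3 y A x * norm (x - y) * norm (H' x)" for x
    using z[of x] by (auto simp: H'_def indicator_def)
  show i2: "integrable ?W (\<lambda>x. bump 3 y A x * (norm (H x))\<^sup>2)"
  proof (rule Bochner_Integration.integrable_bound)
    show "integrable ?W (\<lambda>x. R ^ (2 * 3) * (?I x *\<^sub>R (norm (H x))\<^sup>2))"
      using i by (rule integrable_mult_right)
    show "(\<lambda>x. bump 3 y A x * (norm (H x))\<^sup>2) \<in> borel_measurable ?W"
      unfolding eq using m mb by measurable
    show "AE x in ?W. norm (bump 3 y A x * (norm (H x))\<^sup>2) \<le> norm (R ^ (2 * 3) * (?I x *\<^sub>R (norm (H x))\<^sup>2))"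
    proof (rule AE_I2)
      fix x
      show "norm (bump 3 y A x * (norm (H x))\<^sup>2) \<le> norm (R ^ (2 * 3) * (?I x *\<^sub>R (norm (H x))\<^sup>2))"
        using z[of x] R by (cases "0 < bump 4 y A x") (auto simp: abs_mult intro!: mult_right_mono order_trans[OF bump_le])
    qed
  qed
  have "integrable (weight U V) (bump 3 y A)"
    using V R by (intro integrable_bump) auto
  then have i1: "integrable ?W (bump 3 y A)"
    by (subst integrable_completion) (auto intro: borel_measurable_weight)
  show "integrable ?W (\<lambda>x. bump 3 y A x * norm (x - y) * norm (H x))"
  proof (rule Bochner_Integration.integrable_bound)
    show "integrable ?W (\<lambda>x. R * (bump 3 y A x + bump 3 y A x * (norm (H x))\<^sup>2))"
      using i1 i2 by (intro integrable_mult_right Bochner_Integration.integrable_add)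
    show "(\<lambda>x. bump 3 y A x * norm (x - y) * norm (H x)) \<in> borel_measurable ?W"
      unfolding eq using m mb by measurable
    show "AE x in ?W. norm (bump 3 y A x * norm (x - y) * norm (H x))
        \<le> norm (R * (bump 3 y A x + bump 3 y A x * (norm (H x))\<^sup>2))"
    proof (rule AE_I2)
      fix x
      have "norm (H x) \<le> 1 + (norm (H x))\<^sup>2"
        using zero_le_power2[of "norm (H x) - 1 / 2"] by (simp add: power2_eq_square algebra_simps)
      then have "bump 3 y A x * norm (x - y) * norm (H x) \<le> (bump 3 y A x * R) * (1 + (norm (H x))\<^sup>2)"
        using R(2) by (intro mult_mono[OF bump_times_norm_le[OF R(1,2)]]) auto
      then show "norm (bump 3 y A x * norm (x - y) * norm (H x))
          \<le> norm (R * (bump 3 y A x + bump 3 y A x * (norm (H x))\<^sup>2))"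
        using R(2) by (simp add: abs_mult algebra_simps)
    qed
  qed
qed

text \<open>
  The definition of the mean curvature may be tested with the gradients of the smaller bumps of
  parameter \<open>A - 1 / (j + 1)\<close>; both sides pass to the limit by dominated convergence,
  since bumps increase with \<open>A\<close>.
\<close>
lemma first_variation_bump:
  fixes y :: "real ^ 'd::finite"
  assumes V: "V \<in> varifolds n U" and R: "A \<le> R\<^sup>2" "0 \<le> R" "cball y R \<subseteq> U"
    and gmc: "generalised_mean_curvature U V {x. 0 < bump 4 y A x} H"
    and H: "square_integrable_on (weight U V) {x. 0 < bump 4 y A x} H"
  defines "q \<equiv> \<lambda>A z. 48 * bump 2 y A (fst z) * (norm (proj_matrix (snd z) *v (fst z - y)))\<^sup>2
      - 8 * real n * bump 3 y A (fst z)"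
  shows "integrable (completion V) (q A)"
    and "integrable (completion V) (\<lambda>z. gradient (bump 4 y A) (fst z) \<bullet> H (fst z))"
    and "(\<integral>z. gradient (bump 4 y A) (fst z) \<bullet> H (fst z) \<partial>completion V) = - (\<integral>z. q A z \<partial>completion V)"
proof -
  let ?W = "completion (weight U V)" and ?\<Omega> = "{x. 0 < bump 4 y A x}"
  define As where "As j = A - 1 / real (Suc j)" for j
  define G where "G = (\<lambda>A x. gradient (bump 4 y A) x \<bullet> H x)"
  define H' where "H' = (\<lambda>x. indicator ?\<Omega> x *\<^sub>R H x)"
  have As: "As j < A" for j by (simp add: As_def)
  have As_lim: "As \<longlonglongrightarrow> A"
    unfolding As_def[abs_def] using tendsto_diff[OF tendsto_const LIMSEQ_inverse_real_of_nat, of A]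
    by (simp add: inverse_eq_divide)
  have bump_lim: "(\<lambda>j. bump p y (As j) x) \<longlonglongrightarrow> bump p y A x" for p x
    unfolding bump_def by (intro tendsto_intros As_lim)
  have [measurable]: "fst \<in> borel_measurable V" "(\<lambda>z. (norm (proj_matrix (snd z) *v (fst z - y)))\<^sup>2) \<in> borel_measurable V"
    using measurable_varifold_fst[OF V] measurable_norm_proj_matrix[OF V] by auto
  have q_meas: "q A \<in> borel_measurable V" for A
    unfolding q_def by measurable

  have eqG: "G A' x = gradient (bump 4 y A') x \<bullet> H' x" if "A' \<le> A" for A' x
  proof (cases "0 < bump 4 y A x")
    case False
    then have "bump 3 y A x = 0" by (auto simp: bump_def max_def)
    then have "bump 3 y A' x = 0" using bump_mono[OF that, of 3 y x] bump_nonneg[of 3 y A' x] by linarith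
    then show ?thesis by (simp add: G_def gradient_bump_4)
  qed (simp add: G_def H'_def)
  have H'_meas: "H' \<in> borel_measurable ?W"
    using H by (simp add: square_integrable_on_def set_borel_measurable_def H'_def)
  have grad_meas: "gradient (bump 4 y A') \<in> borel_measurable ?W" for A'
    unfolding gradient_bump_4 by (intro measurable_completion borel_measurable_weight; measurable)
  have G_meas: "G A' \<in> borel_measurable ?W" if "A' \<le> A" for A'
  proof -
    have "G A' = (\<lambda>x. gradient (bump 4 y A') x \<bullet> H' x)" using eqG[OF that] by blast
    then show ?thesis using H'_meas grad_meas by (simp add: borel_measurable_inner)
  qed

  have G_bound: "norm (G A' x) \<le> 8 * (bump 3 y A x * norm (x - y) * norm (H x))" if "A' \<le> A" for A' x
  proof -
    have "norm (G A' x) \<le> norm (gradient (bump 4 y A') x) * norm (H x)"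
      unfolding G_def by (simp add: Cauchy_Schwarz_ineq2)
    also have "\<dots> = 8 * (bump 3 y A' x * norm (x - y) * norm (H x))"
      by (simp add: gradient_bump_4)
    also have "\<dots> \<le> 8 * (bump 3 y A x * norm (x - y) * norm (H x))"
      using bump_mono[OF that] by (intro mult_left_mono mult_right_mono) auto
    finally show ?thesis .
  qed
  note dom = integrable_mult_right[OF square_integrable_bump_integrable(2)[OF V R H], of 8]
  have G_lim: "(\<lambda>j. \<integral>x. G (As j) x \<partial>?W) \<longlonglongrightarrow> (\<integral>x. G A x \<partial>?W)"
  proof (rule integral_dominated_convergence[OF _ _ dom])
    show "AE x in ?W. (\<lambda>j. G (As j) x) \<longlonglongrightarrow> G A x"
      unfolding G_def gradient_bump_4 by (intro AE_I2 tendsto_intros bump_lim)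
  qed (use As G_meas G_bound in \<open>auto simp: less_imp_le\<close>)
  have G_int: "integrable ?W (G A)"
    by (rule Bochner_Integration.integrable_bound[OF dom]) (use G_meas G_bound[of A] in auto)

  let ?d = "\<lambda>x. 48 * R\<^sup>2 * bump 2 y A x + 8 * real n * bump 3 y A x"
  have d: "integrable V (\<lambda>z. ?d (fst z))"
    by (rule integrable_varifold_weight[OF V])
      (intro integrable_mult_right Bochner_Integration.integrable_add integrable_bump[OF V R]; simp)
  have q_bound: "norm (q A' z) \<le> ?d (fst z)" if "A' \<le> A" "z \<in> space V" for A' z
  proof -
    let ?x = "fst z"
    have sub: "subspace (snd z)" using that(2) by (auto simp: space_varifold[OF V] subspace_if_grassmannian)
    have "(norm (proj_matrix (snd z) *v (?x - y)))\<^sup>2 \<le> (norm (?x - y))\<^sup>2"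
      unfolding proj_matrix_mult[OF sub] by (intro power_mono norm_proj_le sub) auto
    then have "bump 2 y A' ?x * (norm (proj_matrix (snd z) *v (?x - y)))\<^sup>2 \<le> bump 2 y A ?x * (norm (?x - y))\<^sup>2"
      using bump_mono[OF that(1)] by (intro mult_mono) auto
    also have "\<dots> \<le> bump 2 y A ?x * R\<^sup>2"
    proof (cases "?x \<in> cball y R")
      case True
      then show ?thesis by (intro mult_left_mono power_mono) (auto simp: dist_norm norm_minus_commute)
    qed (simp add: bump_zero_outside[OF R(1,2)])
    finally have "48 * bump 2 y A' ?x * (norm (proj_matrix (snd z) *v (?x - y)))\<^sup>2 \<le> 48 * R\<^sup>2 * bump 2 y A ?x"
      by (simp add: mult_ac)
    moreover have "0 \<le> 48 * bump 2 y A' ?x * (norm (proj_matrix (snd z) *v (?x - y)))\<^sup>2" by simp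
    moreover have "8 * real n * bump 3 y A' ?x \<le> 8 * real n * bump 3 y A ?x"
      using bump_mono[OF that(1)] by (intro mult_left_mono) auto
    moreover have "0 \<le> 8 * real n * bump 3 y A' ?x" by simp
    ultimately show ?thesis unfolding q_def real_norm_def abs_le_iff by linarith
  qed
  have q_lim: "(\<lambda>j. \<integral>z. q (As j) z \<partial>V) \<longlonglongrightarrow> (\<integral>z. q A z \<partial>V)"
  proof (rule integral_dominated_convergence[OF _ _ d])
    show "AE z in V. (\<lambda>j. q (As j) z) \<longlonglongrightarrow> q A z"
      unfolding q_def by (intro AE_I2 tendsto_intros bump_lim)
  qed (use As q_meas q_bound in \<open>auto simp: less_imp_le\<close>)
  have q_int: "integrable V (q A)"
    by (rule Bochner_Integration.integrable_bound[OF d]) (use q_meas q_bound[of A] in \<open>auto intro!: AE_I2 order_trans[OF _ abs_ge_self]\<close>)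

  have "(\<integral>x. G (As j) x \<partial>?W) = - (\<integral>z. q (As j) z \<partial>V)" for j
  proof -
    have "(\<integral>(x, S). matrix_dot (jacobian (gradient (bump 4 y (As j))) x) (proj_matrix S) \<partial>V)
        = - (\<integral>x. G (As j) x \<partial>?W)"
      using gmc gradient_bump_in_C1c_fields[OF As, of y j]
      by (auto simp: generalised_mean_curvature_def G_def)
    moreover have "(\<integral>(x, S). matrix_dot (jacobian (gradient (bump 4 y (As j))) x) (proj_matrix S) \<partial>V)
        = (\<integral>z. q (As j) z \<partial>V)"
      by (intro Bochner_Integration.integral_cong refl)
        (auto simp: space_varifold[OF V] q_def matrix_dot_jacobian_bump)
    ultimately show ?thesis by simp
  qed
  with G_lim have "(\<lambda>j. - (\<integral>z. q (As j) z \<partial>V)) \<longlonglongrightarrow> (\<integral>x. G A x \<partial>?W)" by simp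
  with tendsto_minus[OF q_lim] have eq: "(\<integral>x. G A x \<partial>?W) = - (\<integral>z. q A z \<partial>V)"
    using LIMSEQ_unique by blast
  have GA: "G A \<in> borel_measurable ?W" using G_meas by simp
  show "integrable (completion V) (q A)"
    using q_int integrable_completion[OF q_meas] by blast
  show "integrable (completion V) (\<lambda>z. gradient (bump 4 y A) (fst z) \<bullet> H (fst z))"
    using G_int integrable_completion_weight[OF V GA] by (simp add: G_def)
  show "(\<integral>z. gradient (bump 4 y A) (fst z) \<bullet> H (fst z) \<partial>completion V) = - (\<integral>z. q A z \<partial>completion V)"
    using eq integral_completion_weight[OF V GA] integral_completion[OF q_meas] by (simp add: G_def)
qed

text \<open>
  Brakke's inequality for a bump $\rho^4$: after replacing the integral of $D\phi \cdot H$ by the first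
  variation, the tangential terms add up to a nonpositive one, and what is left is bounded by
  integrals of $\rho^3$ and $\rho^3|f|^2$. The power 3 is essential, because $\rho^3$ is, up to a constant,
  the decay rate of a bump whose radius shrinks.
\<close>
lemma brakke_variation_bump_le:
  fixes y :: "real ^ 'd::finite"
  assumes B: "brakke_variation n U B" and V: "V \<in> varifolds n U" and f: "f \<in> extensional U"
    and R: "A \<le> R\<^sup>2" "0 \<le> R" "cball y R \<subseteq> U"
  shows "B V (bump 4 y A) f = - \<infinity> \<or>
    square_integrable_on (weight U V) {x. 0 < bump 4 y A x} f \<and>
    B V (bump 4 y A) f \<le> ereal ((8 * real n + 4 * R) * (\<integral>x. bump 3 y A x \<partial>weight U V)
      + (4 * R + R\<^sup>2 / 2) * (\<integral>x. bump 3 y A x * (norm (f x))\<^sup>2 \<partial>completion (weight U V)))"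
proof -
  let ?\<phi> = "bump 4 y A" and ?W = "completion (weight U V)"
  let ?adm = "\<lambda>H. generalised_mean_curvature U V {x. 0 < ?\<phi> x} H \<and>
      square_integrable_on (weight U V) {x. 0 < ?\<phi> x} f \<and> square_integrable_on (weight U V) {x. 0 < ?\<phi> x} H"
  let ?F = "\<lambda>H z. (proj ((snd z)\<^sup>\<bottom>) (gradient ?\<phi> (fst z)) - ?\<phi> (fst z) *\<^sub>R H (fst z)) \<bullet>
      (H (fst z) + proj ((snd z)\<^sup>\<bottom>) (f (fst z)))"
  have \<phi>: "?\<phi> \<in> C2c_nonneg U" using bump_C2c_nonneg[OF R, of 1] by simp
  have cases: "(\<forall>H. ?adm H \<longrightarrow> B V ?\<phi> f \<le> ereal (\<integral>z. ?F H z \<partial>completion V)) \<and>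
      ((\<nexists>H. ?adm H) \<longrightarrow> B V ?\<phi> f = - \<infinity>)"
    using B V \<phi> f unfolding brakke_variation_def Let_def case_prod_beta by blast
  show ?thesis
  proof (cases "\<exists>H. ?adm H")
    case False
    then show ?thesis using cases by blast
  next
    case True
    then obtain H where H: "?adm H" by blast
    define G where "G = (\<lambda>x. (8 * real n + 4 * R) * bump 3 y A x
      + (4 * R + R\<^sup>2 / 2) * (bump 3 y A x * (norm (f x))\<^sup>2))"
    define q where "q = (\<lambda>z. 48 * bump 2 y A (fst z) * (norm (proj_matrix (snd z) *v (fst z - y)))\<^sup>2
      - 8 * real n * bump 3 y A (fst z))"
    define D where "D = (\<lambda>z :: _ \<times> (real ^ 'd) set. gradient ?\<phi> (fst z) \<bullet> H (fst z))"
    \<comment> \<open>the integral of \<open>D + q\<close> vanishes by the first variation\<close>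
    note fv = first_variation_bump[OF V R H[THEN conjunct1] H[THEN conjunct2, THEN conjunct2], folded q_def D_def]
    have sq: "integrable ?W (\<lambda>x. bump 3 y A x * (norm (f x))\<^sup>2)"
      using square_integrable_bump_integrable(1)[OF V R] H by blast
    have b3: "integrable ?W (bump 3 y A)" "(\<integral>x. bump 3 y A x \<partial>?W) = (\<integral>x. bump 3 y A x \<partial>weight U V)"
      using integrable_bump[OF V R, of 3] borel_measurable_weight[OF borel_measurable_bump]
      by (auto simp: integrable_completion integral_completion)
    have G: "integrable ?W G"
      unfolding G_def using sq b3 by (intro Bochner_Integration.integrable_add integrable_mult_right)
    have G_eq: "(\<integral>x. G x \<partial>?W) = (8 * real n + 4 * R) * (\<integral>x. bump 3 y A x \<partial>weight U V)
      + (4 * R + R\<^sup>2 / 2) * (\<integral>x. bump 3 y A x * (norm (f x))\<^sup>2 \<partial>?W)"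
      unfolding G_def using sq b3
      by (subst Bochner_Integration.integral_add) (auto intro!: integrable_mult_right)
    have G_V: "integrable (completion V) (\<lambda>z. G (fst z))" "(\<integral>z. G (fst z) \<partial>completion V) = (\<integral>x. G x \<partial>?W)"
      using integrable_completion_weight[OF V] integral_completion_weight[OF V] G by auto
    have le: "?F H z \<le> D z + q z + G (fst z)" if z: "z \<in> space V" for z
    proof -
      let ?x = "fst z" let ?r = "bump 1 y A ?x"
      have S: "subspace (snd z)" using z by (auto simp: space_varifold[OF V] subspace_if_grassmannian)
      have r: "bump 2 y A ?x = ?r\<^sup>2" "bump 3 y A ?x = ?r ^ 3" "bump 4 y A ?x = ?r ^ 4"
        using bump_eq_power by blast+
      have "?F H z \<le> D z + 48 * ?r\<^sup>2 * (norm (proj (snd z) (?x - y)))\<^sup>2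
          + 8 * ?r ^ 3 * norm (?x - y) * norm (f ?x) + ?r ^ 4 * (norm (f ?x))\<^sup>2 / 2"
        unfolding D_def r(3) by (rule brakke_integrand_le[OF S]) (simp_all add: gradient_bump_4 r)
      moreover have "8 * ?r ^ 3 * norm (?x - y) * norm (f ?x) \<le> 4 * R * ?r ^ 3 * (1 + (norm (f ?x))\<^sup>2)"
      proof -
        have "(?r ^ 3 * norm (?x - y)) * (2 * norm (f ?x)) \<le> (?r ^ 3 * R) * (1 + (norm (f ?x))\<^sup>2)"
          using zero_le_power2[of "norm (f ?x) - 1"] R(2)
          by (intro mult_mono[OF bump_times_norm_le[OF R(1,2), of 3 y ?x, unfolded r]])
            (auto simp: power2_eq_square algebra_simps)
        then show ?thesis by (simp add: algebra_simps)
      qed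
      moreover have "?r ^ 4 * (norm (f ?x))\<^sup>2 / 2 \<le> R\<^sup>2 / 2 * (?r ^ 3 * (norm (f ?x))\<^sup>2)"
      proof -
        have "?r * (?r ^ 3 * (norm (f ?x))\<^sup>2) \<le> R\<^sup>2 * (?r ^ 3 * (norm (f ?x))\<^sup>2)"
          using bump_le[OF R(1), of 1 y ?x] by (intro mult_right_mono) auto
        then show ?thesis by (simp add: power_numeral_reduce)
      qed
      moreover have "D z + q z + G ?x = D z + 48 * ?r\<^sup>2 * (norm (proj (snd z) (?x - y)))\<^sup>2
          + 4 * R * ?r ^ 3 * (1 + (norm (f ?x))\<^sup>2) + R\<^sup>2 / 2 * (?r ^ 3 * (norm (f ?x))\<^sup>2)"
        unfolding q_def G_def r proj_matrix_mult[OF S] by (simp add: algebra_simps)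
      ultimately show ?thesis by linarith
    qed
    have "0 \<le> (\<integral>x. G x \<partial>?W)"
      unfolding G_def using R(2) by (intro integral_nonneg_AE AE_I2) auto
    have "(\<integral>z. ?F H z \<partial>completion V) \<le> (\<integral>x. G x \<partial>?W)"
    proof (cases "integrable (completion V) (?F H)")
      case True
      have "(\<integral>z. ?F H z \<partial>completion V) \<le> (\<integral>z. D z + q z + G (fst z) \<partial>completion V)"
        using True fv(1,2) G_V(1) le by (intro integral_mono Bochner_Integration.integrable_add) auto
      also have "\<dots> = (\<integral>x. G x \<partial>?W)"
        using fv G_V by simp
      finally show ?thesis .
    next
      case False
      \<comment> \<open>the integral is then 0 by convention, and \<open>G\<close> is nonnegative\<close>
      then show ?thesis using \<open>0 \<le> (\<integral>x. G x \<partial>?W)\<close> by (simp add: not_integrable_integral_eq)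
    qed
    moreover have "B V ?\<phi> f \<le> ereal (\<integral>z. ?F H z \<partial>completion V)"
      using cases H by blast
    ultimately have "B V ?\<phi> f \<le> ereal (\<integral>x. G x \<partial>?W)"
      by (meson ereal_less_eq(3) order_trans)
    then show ?thesis using H G_eq by simp
  qed
qed

section \<open>Bounds on the transport term\<close>

lemma real_bound_if_SUP_finite:
  fixes X :: "'a \<Rightarrow> ereal"
  assumes "(SUP t\<in>I. X t) < \<infinity>"
  shows "\<exists>\<Lambda>\<ge>0. \<forall>t\<in>I. X t \<le> ereal \<Lambda>"
proof -
  obtain r where r: "(SUP t\<in>I. X t) < ereal r" using ereal_dense2[OF assms] by blast
  have "X t \<le> ereal (max r 0)" if "t \<in> I" for t
    using SUP_upper[OF that, of X] r by (meson ereal_less_eq(3) less_imp_le max.cobounded1 order_trans)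
  then show ?thesis by (intro exI[of _ "max r 0"]) auto
qed

lemma integral_bump_square_le_Linf:
  fixes f :: "real ^ 'd::finite \<Rightarrow> real ^ 'd"
  assumes V: "V \<in> varifolds n U" and R: "A \<le> R\<^sup>2" "0 \<le> R" "cball y R \<subseteq> U"
    and f: "square_integrable_on (weight U V) {x. 0 < bump 4 y A x} f"
    and \<Lambda>: "Linf_norm (weight U V) (cball y R) f \<le> ereal \<Lambda>" "0 \<le> \<Lambda>"
  shows "(\<integral>x. bump 3 y A x * (norm (f x))\<^sup>2 \<partial>completion (weight U V))
    \<le> \<Lambda>\<^sup>2 * (\<integral>x. bump 3 y A x \<partial>weight U V)"
proof -
  let ?W = "completion (weight U V)"
  let ?M = "restrict_space ?W (cball y R)"
  have "esssup ?M (\<lambda>x. ereal (norm (f x))) \<le> ereal \<Lambda>"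
    using \<Lambda> by (auto simp: Linf_norm_def Let_def split: if_splits)
  then have "AE x in ?M. norm (f x) \<le> \<Lambda>"
    using esssup_AE[of "\<lambda>x. ereal (norm (f x))" ?M] by (auto elim!: eventually_mono dest: order_trans)
  moreover have K: "cball y R \<inter> space ?W \<in> sets ?W"
    using sets_weight[of "cball y R" U V] R(3) by (simp add: Int_absorb2)
  ultimately have AE: "AE x in ?W. x \<in> cball y R \<longrightarrow> norm (f x) \<le> \<Lambda>"
    by (simp add: AE_restrict_space_iff)
  have b3: "integrable ?W (bump 3 y A)" "(\<integral>x. bump 3 y A x \<partial>?W) = (\<integral>x. bump 3 y A x \<partial>weight U V)"
    using integrable_bump[OF V R, of 3] borel_measurable_weight[OF borel_measurable_bump]
    by (auto simp: integrable_completion integral_completion)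
  have "(\<integral>x. bump 3 y A x * (norm (f x))\<^sup>2 \<partial>?W) \<le> (\<integral>x. \<Lambda>\<^sup>2 * bump 3 y A x \<partial>?W)"
  proof (rule integral_mono_AE)
    show "integrable ?W (\<lambda>x. bump 3 y A x * (norm (f x))\<^sup>2)"
      by (rule square_integrable_bump_integrable(1)[OF V R f])
    show "integrable ?W (\<lambda>x. \<Lambda>\<^sup>2 * bump 3 y A x)" using b3 by simp
    show "AE x in ?W. bump 3 y A x * (norm (f x))\<^sup>2 \<le> \<Lambda>\<^sup>2 * bump 3 y A x"
      using AE
    proof eventually_elim
      case (elim x)
      show ?case
      proof (cases "x \<in> cball y R")
        case True
        then have "bump 3 y A x * (norm (f x))\<^sup>2 \<le> bump 3 y A x * \<Lambda>\<^sup>2"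
          using elim by (intro mult_left_mono power_mono) auto
        then show ?thesis by (simp add: mult.commute)
      qed (simp add: bump_zero_outside[OF R(1,2)])
    qed
  qed
  then show ?thesis using b3 by simp
qed

lemma integral_bump_square_le_L2:
  fixes f :: "real ^ 'd::finite \<Rightarrow> real ^ 'd"
  assumes V: "V \<in> varifolds n U" and R: "A \<le> R\<^sup>2" "0 \<le> R" "cball y R \<subseteq> U"
    and f: "square_integrable_on (weight U V) {x. 0 < bump 4 y A x} f"
    and \<Lambda>: "L2_norm (weight U V) (cball y R) f \<le> ereal \<Lambda>" "0 \<le> \<Lambda>"
  shows "(\<integral>x. bump 3 y A x * (norm (f x))\<^sup>2 \<partial>completion (weight U V)) \<le> R ^ 6 * \<Lambda>\<^sup>2"
proof -
  let ?W = "completion (weight U V)"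
  let ?M = "restrict_space ?W (cball y R)" and ?I = "\<lambda>x. indicator (cball y R) x :: real"
  have K: "cball y R \<inter> space ?W \<in> sets ?W"
    using sets_weight[of "cball y R" U V] R(3) by (simp add: Int_absorb2)
  have int: "integrable ?M (\<lambda>x. (norm (f x))\<^sup>2)" and "sqrt (\<integral>x. (norm (f x))\<^sup>2 \<partial>?M) \<le> \<Lambda>"
    using \<Lambda> by (auto simp: L2_norm_def Let_def split: if_splits)
  then have "(\<integral>x. (norm (f x))\<^sup>2 \<partial>?M) \<le> \<Lambda>\<^sup>2"
    using \<Lambda>(2) by (simp add: sqrt_le_D)
  then have le: "(\<integral>x. ?I x *\<^sub>R (norm (f x))\<^sup>2 \<partial>?W) \<le> \<Lambda>\<^sup>2"
    using K by (simp add: integral_restrict_space)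
  have int': "integrable ?W (\<lambda>x. ?I x *\<^sub>R (norm (f x))\<^sup>2)"
    using int K by (simp add: integrable_restrict_space set_integrable_def)
  have "(\<integral>x. bump 3 y A x * (norm (f x))\<^sup>2 \<partial>?W) \<le> (\<integral>x. R ^ 6 * (?I x *\<^sub>R (norm (f x))\<^sup>2) \<partial>?W)"
  proof (rule integral_mono)
    show "integrable ?W (\<lambda>x. bump 3 y A x * (norm (f x))\<^sup>2)"
      by (rule square_integrable_bump_integrable(1)[OF V R f])
    show "integrable ?W (\<lambda>x. R ^ 6 * (?I x *\<^sub>R (norm (f x))\<^sup>2))" using int' by (rule integrable_mult_right)
    show "bump 3 y A x * (norm (f x))\<^sup>2 \<le> R ^ 6 * (?I x *\<^sub>R (norm (f x))\<^sup>2)" for x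
    proof (cases "x \<in> cball y R")
      case True
      then show ?thesis using bump_le[OF R(1), of 3 y x] by (simp add: mult_right_mono)
    qed (simp add: bump_zero_outside[OF R(1,2)])
  qed
  also have "\<dots> = R ^ 6 * (\<integral>x. ?I x *\<^sub>R (norm (f x))\<^sup>2 \<partial>?W)" by simp
  also have "\<dots> \<le> R ^ 6 * \<Lambda>\<^sup>2" using le R by (intro mult_left_mono) auto
  finally show ?thesis .
qed

text \<open>
  The two alternative hypotheses on \<open>u\<close> bound the integral of $\rho^3|u|^2$ by a multiple of the
  integral of $\rho^3$ and by a constant, respectively. A bound by the sum of both covers either case.
\<close>
lemma brakke_variation_bump_uniform_bound:
  fixes U :: "(real ^ 'd::finite) set"
  assumes B: "brakke_variation n U B" and V: "\<forall>t\<in>I. V t \<in> varifolds n U"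
    and u: "\<forall>t\<in>I. u t \<in> extensional U"
    and bound: "(\<forall>K\<in>sets borel. relatively_compact_in K U \<longrightarrow>
            (SUP t\<in>I. Linf_norm (weight U (V t)) K (u t)) < \<infinity>) \<or>
         (\<forall>K\<in>sets borel. relatively_compact_in K U \<longrightarrow>
            (SUP t\<in>I. L2_norm (weight U (V t)) K (u t)) < \<infinity>)"
    and R: "0 \<le> R" "cball y R \<subseteq> U"
  shows "\<exists>D\<ge>0. \<forall>t\<in>I. \<forall>A\<le>R\<^sup>2.
    B (V t) (bump 4 y A) (u t) \<le> ereal (D * (\<integral>x. bump 3 y A x \<partial>weight U (V t)) + D)"
proof -
  have K: "cball y R \<in> sets borel" "relatively_compact_in (cball y R) U"
    using R by (auto simp: relatively_compact_in_def)
  have "(SUP t\<in>I. Linf_norm (weight U (V t)) (cball y R) (u t)) < \<infinity> \<or>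
      (SUP t\<in>I. L2_norm (weight U (V t)) (cball y R) (u t)) < \<infinity>"
    using bound K by blast
  then obtain \<Lambda> where \<Lambda>: "0 \<le> \<Lambda>"
    "(\<forall>t\<in>I. Linf_norm (weight U (V t)) (cball y R) (u t) \<le> ereal \<Lambda>) \<or>
     (\<forall>t\<in>I. L2_norm (weight U (V t)) (cball y R) (u t) \<le> ereal \<Lambda>)"
  proof (elim disjE)
    assume "(SUP t\<in>I. Linf_norm (weight U (V t)) (cball y R) (u t)) < \<infinity>"
    from real_bound_if_SUP_finite[OF this] that show ?thesis by blast
  next
    assume "(SUP t\<in>I. L2_norm (weight U (V t)) (cball y R) (u t)) < \<infinity>"
    from real_bound_if_SUP_finite[OF this] that show ?thesis by blast
  qed
  define a b where "a = 8 * real n + 4 * R" and "b = 4 * R + R\<^sup>2 / 2"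
  have ab: "0 \<le> a" "0 \<le> b" using R by (auto simp: a_def b_def)
  define D where "D = a + b * (\<Lambda>\<^sup>2 + R ^ 6 * \<Lambda>\<^sup>2)"
  have D: "0 \<le> D" using ab R by (simp add: D_def)
  show ?thesis
  proof (intro exI[of _ D] conjI ballI allI impI D)
    fix t A assume t: "t \<in> I" and A: "A \<le> R\<^sup>2"
    let ?W = "weight U (V t)"
    let ?i = "\<integral>x. bump 3 y A x \<partial>?W" and ?j = "\<integral>x. bump 3 y A x * (norm (u t x))\<^sup>2 \<partial>completion ?W"
    have Vt: "V t \<in> varifolds n U" and ut: "u t \<in> extensional U" using V u t by auto
    have i: "0 \<le> ?i" by (intro integral_nonneg_AE AE_I2) simp
    have "B (V t) (bump 4 y A) (u t) \<le> ereal (D * ?i + D)"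
      if f: "square_integrable_on ?W {x. 0 < bump 4 y A x} (u t)"
        and le: "B (V t) (bump 4 y A) (u t) \<le> ereal (a * ?i + b * ?j)"
    proof -
      have "?j \<le> \<Lambda>\<^sup>2 * ?i \<or> ?j \<le> R ^ 6 * \<Lambda>\<^sup>2"
        using \<Lambda> t integral_bump_square_le_Linf[OF Vt A R f _ \<Lambda>(1)]
          integral_bump_square_le_L2[OF Vt A R f _ \<Lambda>(1)] by blast
      moreover have "0 \<le> \<Lambda>\<^sup>2" "0 \<le> \<Lambda>\<^sup>2 * ?i" "0 \<le> R ^ 6 * \<Lambda>\<^sup>2" "0 \<le> R ^ 6 * \<Lambda>\<^sup>2 * ?i"
        using i R by auto
      moreover have "(\<Lambda>\<^sup>2 + R ^ 6 * \<Lambda>\<^sup>2) * (?i + 1) = \<Lambda>\<^sup>2 * ?i + R ^ 6 * \<Lambda>\<^sup>2 * ?i + \<Lambda>\<^sup>2 + R ^ 6 * \<Lambda>\<^sup>2"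
        by (simp add: algebra_simps)
      ultimately have "?j \<le> (\<Lambda>\<^sup>2 + R ^ 6 * \<Lambda>\<^sup>2) * (?i + 1)" by linarith
      then have "b * ?j \<le> b * ((\<Lambda>\<^sup>2 + R ^ 6 * \<Lambda>\<^sup>2) * (?i + 1))" using ab by (intro mult_left_mono)
      then have "a * ?i + b * ?j \<le> D * ?i + D" using ab by (simp add: D_def algebra_simps)
      then show ?thesis using le by (meson ereal_less_eq(3) order_trans)
    qed
    then show "B (V t) (bump 4 y A) (u t) \<le> ereal (D * ?i + D)"
      using brakke_variation_bump_le[OF B Vt ut A R] by (auto simp: a_def b_def)
  qed
qed


section \<open>One-sided control of difference quotients\<close>

text \<open>
  An abstraction of the functionals $L_t(\phi) = \int \phi\, d\|V_t\|$. The last assumption is one-sided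
  semicontinuity with a rate: as \<open>t\<close> increases, \<open>L t \<phi>\<close> may jump downwards, but not upwards.
\<close>
locale positive_functionals =
  fixes I :: "real set" and U :: "(real ^ 'd::finite) set"
    and L :: "real \<Rightarrow> (real ^ 'd \<Rightarrow> real) \<Rightarrow> real"
  assumes linear: "\<And>t \<phi> \<psi> a b. t \<in> I \<Longrightarrow> \<phi> \<in> C2c U \<Longrightarrow> \<psi> \<in> C2c U \<Longrightarrow>
      L t (\<lambda>x. a * \<phi> x + b * \<psi> x) = a * L t \<phi> + b * L t \<psi>"
    and mono: "\<And>t \<phi> \<psi>. t \<in> I \<Longrightarrow> \<phi> \<in> C2c U \<Longrightarrow> \<psi> \<in> C2c U \<Longrightarrow> (\<And>x. \<phi> x \<le> \<psi> x) \<Longrightarrow>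
      L t \<phi> \<le> L t \<psi>"
    and quotient_bounded: "\<And>s \<phi>. s \<in> I \<Longrightarrow> \<phi> \<in> C2c_nonneg U \<Longrightarrow>
      \<exists>C. \<forall>\<^sub>F t in at s within I. (L t \<phi> - L s \<phi>) / (t - s) \<le> C"
begin

lemma scale: "t \<in> I \<Longrightarrow> \<phi> \<in> C2c U \<Longrightarrow> L t (\<lambda>x. a * \<phi> x) = a * L t \<phi>"
  using linear[of t \<phi> \<phi> a 0] by simp

lemma nonneg:
  assumes "t \<in> I" "\<phi> \<in> C2c_nonneg U"
  shows "0 \<le> L t \<phi>"
proof -
  have "L t (\<lambda>x. 0 * \<phi> x) \<le> L t \<phi>"
    using assms by (intro mono C2c_scale) (auto simp: C2c_nonneg_def)
  then show ?thesis using scale[of t \<phi> 0] assms by (simp add: C2c_nonneg_def)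
qed

lemma functional_sum:
  assumes "t \<in> I" "finite F" "\<And>i. i \<in> F \<Longrightarrow> \<phi> i \<in> C2c U"
  shows "L t (\<lambda>x. \<Sum>i\<in>F. \<phi> i x) = (\<Sum>i\<in>F. L t (\<phi> i))"
  using assms(2,3)
proof (induction F rule: finite_induct)
  case empty
  then show ?case using scale[OF assms(1) C2c_zero, of 0] by simp
next
  case (insert i F)
  then have "L t (\<lambda>x. 1 * \<phi> i x + 1 * (\<Sum>j\<in>F. \<phi> j x)) = 1 * L t (\<phi> i) + 1 * L t (\<lambda>x. \<Sum>j\<in>F. \<phi> j x)"
    using assms(1) by (intro linear C2c_sum) auto
  with insert show ?case by simp
qed

text \<open>
  The heart of the argument, on one side \<open>\<sigma>\<close> of \<open>s\<close>. Since \<open>L t \<psi>\<close> need not converge to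
  \<open>L s \<psi>\<close>, semicontinuity is applied to the nonnegative function
  \<open>\<theta> = \<sigma> * \<psi> + \<epsilon> * \<eta> + M * \<phi> s\<close>. This yields the upper bound
  $L_t\psi \le L_s\psi + C|t-s| + \epsilon m' - M|t-s|q$, where \<open>q\<close> is the difference quotient of the
  fixed function \<open>\<phi> s\<close>. The last term turns \<open>q\<close> into \<open>(1 - M * \<bar>t - s\<bar>) * q\<close>, so a
  jump of \<open>L\<close> is compensated by a quotient \<open>q\<close> that tends to \<open>-\<infinity>\<close>.
\<close>
lemma one_sided_quotient_le:
  assumes s: "s \<in> I" and \<sigma>: "\<sigma> = 1 \<or> \<sigma> = -1"
    and J: "J \<subseteq> I" "\<And>t. t \<in> J \<Longrightarrow> 0 \<le> \<sigma> * (t - s)"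
    and \<phi>: "\<phi> s \<in> C2c_nonneg U" "\<And>t. t \<in> J \<Longrightarrow> \<phi> t \<in> C2c U"
    and \<psi>: "\<psi> \<in> C2c U" and \<eta>: "\<eta> \<in> C2c_nonneg U"
    and bounded: "\<forall>\<^sub>F t in at s within J. L t \<eta> \<le> m"
    and difference: "\<And>\<epsilon>. 0 < \<epsilon> \<Longrightarrow>
      \<forall>\<^sub>F t in at s within J. \<forall>x. (\<phi> t x - \<phi> s x) / (t - s) \<le> \<psi> x + \<epsilon> * \<eta> x"
    and sign: "\<And>\<epsilon>. 0 < \<epsilon> \<Longrightarrow> \<exists>M\<ge>0. \<forall>x. 0 \<le> \<sigma> * \<psi> x + \<epsilon> * \<eta> x + M * \<phi> s x"
    and quotient: "\<forall>\<^sub>F t in at s within J. (L t (\<phi> s) - L s (\<phi> s)) / (t - s) \<le> r"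
    and \<delta>: "0 < \<delta>"
  shows "\<forall>\<^sub>F t in at s within J. (L t (\<phi> t) - L s (\<phi> s)) / (t - s) \<le> r + L s \<psi> + \<delta>"
proof -
  have \<phi>s: "\<phi> s \<in> C2c U" and \<eta>': "\<eta> \<in> C2c U" using \<phi> \<eta> by (auto simp: C2c_nonneg_def)
  define m' where "m' = max m (L s \<eta>)"
  have m': "0 \<le> m'" using nonneg[OF s \<eta>] by (simp add: m'_def)
  \<comment> \<open>the bounds 2 and 3 below each cost \<open>\<epsilon> * m'\<close>, at most a quarter of \<open>\<delta>\<close>\<close>
  define \<epsilon> where "\<epsilon> = \<delta> / (4 * (m' + 1))"
  have \<epsilon>: "0 < \<epsilon>" using \<delta> m' by (simp add: \<epsilon>_def)
  have \<epsilon>m: "\<epsilon> * m' \<le> \<delta> / 4" using \<delta> m' by (simp add: \<epsilon>_def field_simps)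
  obtain M where M: "0 \<le> M" "\<And>x. 0 \<le> \<sigma> * \<psi> x + \<epsilon> * \<eta> x + M * \<phi> s x"
    using sign[OF \<epsilon>] by blast
  define \<theta> where "\<theta> = (\<lambda>x. 1 * (\<sigma> * \<psi> x + \<epsilon> * \<eta> x) + M * \<phi> s x)"
  have \<theta>: "\<theta> \<in> C2c_nonneg U"
    using M C2c_add_scale[OF C2c_add_scale[OF \<psi> \<eta>', of \<sigma> \<epsilon>] \<phi>s, of 1 M]
    by (simp add: \<theta>_def C2c_nonneg_def)
  have L\<theta>: "L t \<theta> = \<sigma> * L t \<psi> + \<epsilon> * L t \<eta> + M * L t (\<phi> s)" if "t \<in> I" for t
    using linear[OF that C2c_add_scale[OF \<psi> \<eta>', of \<sigma> \<epsilon>] \<phi>s, of 1 M]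
      linear[OF that \<psi> \<eta>', of \<sigma> \<epsilon>] by (simp add: \<theta>_def)
  obtain C where C: "\<forall>\<^sub>F t in at s within I. (L t \<theta> - L s \<theta>) / (t - s) \<le> C"
    using quotient_bounded[OF s \<theta>] by blast
  then have C': "\<forall>\<^sub>F t in at s within J. (L t \<theta> - L s \<theta>) / (t - s) \<le> C"
    using J(1) by (meson at_le filter_leD)
  have "((\<lambda>t. (\<bar>C\<bar> + M * \<bar>r\<bar>) * \<bar>t - s\<bar>) \<longlongrightarrow> (\<bar>C\<bar> + M * \<bar>r\<bar>) * \<bar>s - s\<bar>) (at s within J)"
    by (intro tendsto_intros)
  then have small1: "\<forall>\<^sub>F t in at s within J. (\<bar>C\<bar> + M * \<bar>r\<bar>) * \<bar>t - s\<bar> < \<delta> / 4"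
    using \<delta> by (intro order_tendstoD) auto
  have "((\<lambda>t. M * \<bar>t - s\<bar>) \<longlongrightarrow> M * \<bar>s - s\<bar>) (at s within J)"
    by (intro tendsto_intros)
  then have small2: "\<forall>\<^sub>F t in at s within J. M * \<bar>t - s\<bar> < 1"
    by (intro order_tendstoD) auto
  have "\<forall>\<^sub>F t in at s within J. t \<in> J \<and> t \<noteq> s"
    by (simp add: eventually_at_filter)
  then show ?thesis
    using C' small1 small2 bounded difference[OF \<epsilon>] quotient
  proof eventually_elim
    case (elim t)
    define h q where "h = t - s" and "q = (L t (\<phi> s) - L s (\<phi> s)) / h"
    have t: "t \<in> J" "t \<in> I" "h \<noteq> 0" using elim J by (auto simp: h_def)
    have abs_h: "\<bar>h\<bar> = \<sigma> * h" using J(2)[OF t(1)] \<sigma> by (auto simp: h_def)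
    have "L t (\<lambda>x. (1 / h) * \<phi> t x + (- 1 / h) * \<phi> s x) \<le> L t (\<lambda>x. 1 * \<psi> x + \<epsilon> * \<eta> x)"
      using elim(6) t \<phi>(2) \<phi>s \<psi> \<eta>'
      by (intro mono C2c_add_scale) (auto simp: h_def diff_divide_distrib)
    then have "L t (\<phi> t) / h - L t (\<phi> s) / h \<le> L t \<psi> + \<epsilon> * L t \<eta>"
      using linear[OF t(2) \<phi>(2)[OF t(1)] \<phi>s, of "1 / h" "- 1 / h"] linear[OF t(2) \<psi> \<eta>', of 1 \<epsilon>] by simp
    then have 1: "(L t (\<phi> t) - L s (\<phi> s)) / h \<le> q + L t \<psi> + \<epsilon> * L t \<eta>"
      by (simp add: q_def diff_divide_distrib)
    have "(L t \<theta> - L s \<theta>) / h * \<bar>h\<bar> \<le> C * \<bar>h\<bar>"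
      using elim(2) by (intro mult_right_mono) (auto simp: h_def)
    then have "\<sigma> * (L t \<theta> - L s \<theta>) \<le> C * \<bar>h\<bar>"
      using t(3) by (simp add: abs_h mult.commute)
    moreover have "\<sigma> * (L t \<theta> - L s \<theta>) = (L t \<psi> - L s \<psi>) + \<epsilon> * (\<sigma> * (L t \<eta> - L s \<eta>)) + M * \<bar>h\<bar> * q"
    proof -
      have "L t (\<phi> s) - L s (\<phi> s) = h * q" using t(3) by (simp add: q_def)
      then have "L t (\<phi> s) = L s (\<phi> s) + h * q" by simp
      then show ?thesis
        using \<sigma> by (auto simp: L\<theta>[OF t(2)] L\<theta>[OF s] abs_h algebra_simps)
    qed
    moreover have "\<bar>L t \<eta> - L s \<eta>\<bar> \<le> m'"
      using elim(5) nonneg[OF s \<eta>] nonneg[OF t(2) \<eta>] by (auto simp: m'_def)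
    then have "\<epsilon> * (- m') \<le> \<epsilon> * (\<sigma> * (L t \<eta> - L s \<eta>))"
      using \<epsilon> \<sigma> by (intro mult_left_mono) auto
    ultimately have 2: "L t \<psi> \<le> L s \<psi> + C * \<bar>h\<bar> + \<epsilon> * m' - M * \<bar>h\<bar> * q"
      by simp
    have 3: "\<epsilon> * L t \<eta> \<le> \<epsilon> * m'"
      using \<epsilon> elim(5) by (intro mult_left_mono) (auto simp: m'_def)
    have "q * (1 - M * \<bar>h\<bar>) \<le> r * (1 - M * \<bar>h\<bar>)"
      using elim(4,7) by (intro mult_right_mono) (auto simp: q_def h_def)
    then have 4: "q - M * \<bar>h\<bar> * q \<le> r - r * (M * \<bar>h\<bar>)"
      by (simp add: algebra_simps)
    have "- \<bar>r\<bar> * (M * \<bar>h\<bar>) \<le> r * (M * \<bar>h\<bar>)"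
      using M by (intro mult_right_mono) auto
    moreover have "C * \<bar>h\<bar> \<le> \<bar>C\<bar> * \<bar>h\<bar>" by (intro mult_right_mono) auto
    moreover have "(\<bar>C\<bar> + M * \<bar>r\<bar>) * \<bar>h\<bar> = \<bar>C\<bar> * \<bar>h\<bar> + \<bar>r\<bar> * (M * \<bar>h\<bar>)" by (simp add: algebra_simps)
    ultimately have "C * \<bar>h\<bar> - r * (M * \<bar>h\<bar>) \<le> \<delta> / 4"
      using elim(3) by (simp add: h_def)
    with 1 2 3 4 \<epsilon>m \<delta> show ?case by (simp add: h_def)
  qed
qed

lemma bounded_on_right:
  assumes s: "s \<in> I" and J: "J \<subseteq> I" "\<And>t. t \<in> J \<Longrightarrow> s \<le> t" and \<eta>: "\<eta> \<in> C2c_nonneg U"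
  shows "\<exists>m. \<forall>\<^sub>F t in at s within J. L t \<eta> \<le> m"
proof -
  obtain C where "\<forall>\<^sub>F t in at s within I. (L t \<eta> - L s \<eta>) / (t - s) \<le> C"
    using quotient_bounded[OF s \<eta>] by blast
  then have C: "\<forall>\<^sub>F t in at s within J. (L t \<eta> - L s \<eta>) / (t - s) \<le> C"
    using J(1) by (meson at_le filter_leD)
  have "\<forall>\<^sub>F t in at s within J. t \<in> J \<and> t \<noteq> s \<and> dist t s < 1"
    by (auto simp: eventually_at intro: exI[of _ 1])
  with C have "\<forall>\<^sub>F t in at s within J. L t \<eta> \<le> L s \<eta> + \<bar>C\<bar>"
  proof eventually_elim
    case (elim t)
    then have t: "0 < t - s" "t - s \<le> 1" using J(2)[of t] by (auto simp: dist_real_def)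
    then have "L t \<eta> - L s \<eta> \<le> C * (t - s)" using elim(1) by (simp add: field_simps)
    also have "\<dots> \<le> \<bar>C\<bar> * 1" using t by (intro mult_mono) auto
    finally show ?case by simp
  qed
  then show ?thesis by blast
qed

lemma lower_semicontinuous_on_left:
  assumes s: "s \<in> I" and J: "J \<subseteq> I" "\<And>t. t \<in> J \<Longrightarrow> t \<le> s" and \<phi>: "\<phi> \<in> C2c_nonneg U" and \<delta>: "0 < \<delta>"
  shows "\<forall>\<^sub>F t in at s within J. L s \<phi> \<le> L t \<phi> + \<delta>"
proof -
  obtain C where "\<forall>\<^sub>F t in at s within I. (L t \<phi> - L s \<phi>) / (t - s) \<le> C"
    using quotient_bounded[OF s \<phi>] by blast
  then have C: "\<forall>\<^sub>F t in at s within J. (L t \<phi> - L s \<phi>) / (t - s) \<le> C"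
    using J(1) by (meson at_le filter_leD)
  have "((\<lambda>t. C * (s - t)) \<longlongrightarrow> C * (s - s)) (at s within J)" by (intro tendsto_intros)
  then have small: "\<forall>\<^sub>F t in at s within J. C * (s - t) < \<delta>"
    using \<delta> by (intro order_tendstoD) auto
  have "\<forall>\<^sub>F t in at s within J. t \<in> J \<and> t \<noteq> s" by (simp add: eventually_at_filter)
  with C small show ?thesis
  proof eventually_elim
    case (elim t)
    then have "t - s < 0" using J(2)[of t] by auto
    then have "C * (t - s) \<le> L t \<phi> - L s \<phi>" using elim(1) by (simp add: field_simps)
    then show ?case using elim(2) by (simp add: algebra_simps)
  qed
qed

end

text \<open>
  Continuity of \<open>g\<close> is replaced by lower semicontinuity from the left, which is enough for the set
  of good times to contain its supremum.
\<close>
lemma growth_bound_from_right_quotients: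
  fixes g :: "real \<Rightarrow> real"
  assumes ab: "a \<le> b"
    and right: "\<And>s \<delta>. a \<le> s \<Longrightarrow> s < b \<Longrightarrow> 0 < \<delta> \<Longrightarrow> \<forall>\<^sub>F t in at_right s. (g t - g s) / (t - s) \<le> C + \<delta>"
    and left: "\<And>s \<delta>. a < s \<Longrightarrow> s \<le> b \<Longrightarrow> 0 < \<delta> \<Longrightarrow> \<forall>\<^sub>F t in at_left s. g s \<le> g t + \<delta>"
  shows "g b \<le> g a + C * (b - a)"
proof -
  have main: "g b \<le> g a + D * (b - a)" if "C < D" for D
  proof -
    define T where "T = {\<tau>\<in>{a..b}. \<forall>t\<in>{a..\<tau>}. g t \<le> g a + D * (t - a)}"
    define c where "c = Sup T"
    have aT: "a \<in> T" using ab by (auto simp: T_def)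
    have bdd: "bdd_above T" unfolding T_def by (rule bdd_aboveI[of _ b]) auto
    have "c \<le> b"
      unfolding c_def
    proof (rule cSup_least)
      show "T \<noteq> {}" using aT by blast
      show "\<tau> \<le> b" if "\<tau> \<in> T" for \<tau> using that by (simp add: T_def)
    qed
    with cSup_upper[OF aT bdd] have c: "a \<le> c" "c \<le> b" by (simp_all add: c_def)
    have below: "g t \<le> g a + D * (t - a)" if "a \<le> t" "t < c" for t
    proof -
      obtain \<tau> where "\<tau> \<in> T" "t < \<tau>"
        using \<open>t < c\<close> aT less_cSup_iff[OF _ bdd, of t] unfolding c_def by blast
      then show ?thesis using that by (simp add: T_def)
    qed
    have at_c: "g c \<le> g a + D * (c - a)"
    proof (cases "a = c")
      case False
      then have "a < c" using c by simp
      show ?thesis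
      proof (rule field_le_epsilon)
        fix e :: real assume "0 < e"
        have "((\<lambda>t. g a + D * (t - a)) \<longlongrightarrow> g a + D * (c - a)) (at_left c)" by (intro tendsto_intros)
        then have "\<forall>\<^sub>F t in at_left c. g a + D * (t - a) < g a + D * (c - a) + e / 2"
          using \<open>0 < e\<close> by (intro order_tendstoD) auto
        moreover have "\<forall>\<^sub>F t in at_left c. g c \<le> g t + e / 2"
          using left[OF \<open>a < c\<close> c(2)] \<open>0 < e\<close> by auto
        moreover have "\<forall>\<^sub>F t in at_left c. a < t \<and> t < c"
          using eventually_at_left[OF \<open>a < c\<close>] \<open>a < c\<close> by blast
        ultimately have "\<forall>\<^sub>F t in at_left c. g c \<le> g a + D * (c - a) + e"
        proof eventually_elim
          case (elim t)
          then show ?case using below[of t] by simp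
        qed
        then show "g c \<le> g a + D * (c - a) + e" by simp
      qed
    qed simp
    have "c = b"
    proof (rule ccontr)
      assume "c \<noteq> b"
      then have "c < b" using c by simp
      have "\<forall>\<^sub>F t in at_right c. (g t - g c) / (t - c) \<le> C + (D - C)"
        using right[OF c(1) \<open>c < b\<close>, of "D - C"] that by simp
      then obtain d where d: "c < d" "\<And>t. c < t \<Longrightarrow> t < d \<Longrightarrow> (g t - g c) / (t - c) \<le> D"
        using eventually_at_right[OF \<open>c < b\<close>] by auto
      obtain \<tau> where \<tau>: "c < \<tau>" "\<tau> < min d b" using dense[of c "min d b"] d \<open>c < b\<close> by auto
      have "g t \<le> g a + D * (t - a)" if t: "a \<le> t" "t \<le> \<tau>" for t
      proof (cases t c rule: linorder_cases)
        case less then show ?thesis using below t by simp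
      next
        case equal then show ?thesis using at_c by simp
      next
        case greater
        then have "(g t - g c) / (t - c) \<le> D" using d(2) t \<tau> by simp
        then have "g t - g c \<le> D * (t - c)" using greater by (simp add: field_simps)
        then show ?thesis using at_c by (simp add: algebra_simps)
      qed
      then have "\<tau> \<in> T" using \<tau> c by (auto simp: T_def)
      then show False using \<tau> bdd cSup_upper unfolding c_def by (metis not_less)
    qed
    then show ?thesis using at_c by simp
  qed
  show ?thesis
  proof (rule field_le_epsilon)
    fix e :: real assume "0 < e"
    define D where "D = C + e / (b - a + 1)"
    have "C < D" using \<open>0 < e\<close> ab by (simp add: D_def)
    have "(D - C) * (b - a) \<le> (D - C) * (b - a + 1)"
      using \<open>C < D\<close> by (intro mult_left_mono) auto
    also have "\<dots> = e" using ab by (simp add: D_def)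
    finally show "g b \<le> g a + C * (b - a) + e"
      using main[OF \<open>C < D\<close>] by (simp add: algebra_simps)
  qed
qed

section \<open>Shrinking bumps as barriers\<close>

text \<open>
  Taylor's formula with a quadratic upper bound for the remainder, valid across the kink of the positive part.
\<close>
lemma pos_part_power4_le:
  fixes \<rho> k :: real
  assumes "0 \<le> k"
  shows "(max 0 (\<rho> - k)) ^ 4 \<le> (max 0 \<rho>) ^ 4 - 4 * k * (max 0 \<rho>) ^ 3 + 6 * k\<^sup>2 * (max 0 \<rho>)\<^sup>2"
proof (cases "k \<le> \<rho>")
  case True
  have "(\<rho> - k) ^ 4 = \<rho> ^ 4 - 4 * k * \<rho> ^ 3 + 6 * k\<^sup>2 * \<rho>\<^sup>2 - k ^ 3 * (4 * \<rho> - k)"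
    by (simp add: power2_eq_square power3_eq_cube power4_eq_xxxx algebra_simps)
  moreover have "0 \<le> k ^ 3 * (4 * \<rho> - k)" using True assms by simp
  ultimately show ?thesis using True assms by (simp add: max_def)
next
  case False
  let ?r = "max 0 \<rho>"
  have "?r ^ 4 - 4 * k * ?r ^ 3 + 6 * k\<^sup>2 * ?r\<^sup>2 = ?r\<^sup>2 * ((?r - 2 * k)\<^sup>2 + 2 * k\<^sup>2)"
    by (simp add: power2_eq_square power3_eq_cube power4_eq_xxxx algebra_simps)
  then have "0 \<le> ?r ^ 4 - 4 * k * ?r ^ 3 + 6 * k\<^sup>2 * ?r\<^sup>2" by simp
  then show ?thesis using False by simp
qed

context positive_functionals
begin

text \<open>
  The radius shrinks at a speed \<open>c\<close> for which the decay of the bump, $-4c$ times the integral of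
  $\rho^3$, absorbs the growth rate in \<open>decay\<close>. Two properties make the argument independent of any
  a priori mass bound: to the right of \<open>s\<close> the mass is bounded by semicontinuity, and from the left
  only lower semicontinuity is required, which holds because the bumps decrease in time.
\<close>
lemma barrier:
  fixes y :: "real ^ 'd"
  assumes U: "open U" and R: "0 < R" "cball y R \<subseteq> U" and D: "0 \<le> D"
    and ab: "{a..b} \<subseteq> I" "a \<le> b"
    and decay: "\<And>s A r. s \<in> I \<Longrightarrow> A \<le> R\<^sup>2 \<Longrightarrow> D * L s (bump 3 y A) + D < r \<Longrightarrow>
      \<forall>\<^sub>F t in at s within I. (L t (bump 4 y A) - L s (bump 4 y A)) / (t - s) \<le> r"
    and c: "D \<le> 4 * c" "0 \<le> c"
  shows "L b (bump 4 y (R\<^sup>2 - c * (b - a))) \<le> L a (bump 4 y (R\<^sup>2)) + D * (b - a)"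
proof -
  define A where "A t = R\<^sup>2 - c * (t - a)" for t
  have A_le: "A t \<le> R\<^sup>2" if "a \<le> t" for t using that c by (simp add: A_def)
  have b4: "bump 4 y (A t) \<in> C2c_nonneg U" "bump 3 y (A t) \<in> C2c_nonneg U" if "a \<le> t" for t
    using bump_C2c_nonneg[OF A_le[OF that] _ R(2), of 1] bump_C2c_nonneg[OF A_le[OF that] _ R(2), of 0] R(1) by auto
  obtain \<eta> where \<eta>: "\<eta> \<in> C2c_nonneg U" "\<And>x. x \<in> cball y R \<Longrightarrow> 1 \<le> \<eta> x"
    using exists_cutoff[OF U _ R(2)] by auto
  have \<eta>0: "0 \<le> \<eta> x" for x using \<eta> by (simp add: C2c_nonneg_def)
  have "L b (bump 4 y (A b)) \<le> L a (bump 4 y (A a)) + D * (b - a)"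
  proof (rule growth_bound_from_right_quotients[OF ab(2)])
    fix s \<delta> :: real assume s: "a < s" "s \<le> b" and \<delta>: "0 < \<delta>"
    have "\<forall>\<^sub>F t in at s within {a..s}. L s (bump 4 y (A s)) \<le> L t (bump 4 y (A s)) + \<delta>"
      using s ab b4 \<delta> by (intro lower_semicontinuous_on_left) auto
    moreover have "\<forall>\<^sub>F t in at s within {a..s}. t \<in> {a..s}" by (simp add: eventually_at_filter)
    ultimately have "\<forall>\<^sub>F t in at s within {a..s}. L s (bump 4 y (A s)) \<le> L t (bump 4 y (A t)) + \<delta>"
    proof eventually_elim
      case t: (elim t)
      have "A s \<le> A t" using t c by (auto simp: A_def intro: mult_left_mono)
      then have "L t (bump 4 y (A s)) \<le> L t (bump 4 y (A t))"
        using t s ab b4 by (intro mono bump_mono) (auto simp: C2c_nonneg_def)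
      then show ?case using t by simp
    qed
    then show "\<forall>\<^sub>F t in at_left s. L s (bump 4 y (A s)) \<le> L t (bump 4 y (A t)) + \<delta>"
      using at_within_Icc_at_left[OF s(1)] by simp
  next
    fix s \<delta> :: real assume s: "a \<le> s" "s < b" and \<delta>: "0 < \<delta>"
    have J: "{s..b} \<subseteq> I" "s \<in> I" using s ab by auto
    define \<psi> where "\<psi> = (\<lambda>x. (- 4 * c) * bump 3 y (A s) x)"
    have \<psi>: "\<psi> \<in> C2c U" using C2c_scale[of "bump 3 y (A s)" U "- 4 * c"] b4[OF s(1)]
      by (simp add: \<psi>_def C2c_nonneg_def)
    obtain m where m: "\<forall>\<^sub>F t in at s within {s..b}. L t \<eta> \<le> m"
      using bounded_on_right[OF J(2,1) _ \<eta>(1)] by auto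
    \<comment> \<open>half of \<open>\<delta>\<close> pays for the strict inequality in \<open>decay\<close>\<close>
    let ?r = "D * L s (bump 3 y (A s)) + D + \<delta> / 2"
    have "\<forall>\<^sub>F t in at s within {s..b}. (L t (bump 4 y (A t)) - L s (bump 4 y (A s))) / (t - s)
        \<le> ?r + L s \<psi> + \<delta> / 2"
    proof (rule one_sided_quotient_le[where \<sigma> = 1 and \<eta> = \<eta> and m = m and \<phi> = "\<lambda>t. bump 4 y (A t)"])
      fix \<epsilon> :: real assume \<epsilon>: "0 < \<epsilon>"
      \<comment> \<open>the remainder of \<open>pos_part_power4_le\<close>, divided by \<open>t - s\<close>\<close>
      have "((\<lambda>t. 6 * c\<^sup>2 * (t - s) * R ^ 4) \<longlongrightarrow> 6 * c\<^sup>2 * (s - s) * R ^ 4) (at s within {s..b})"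
        by (intro tendsto_intros)
      then have "\<forall>\<^sub>F t in at s within {s..b}. 6 * c\<^sup>2 * (t - s) * R ^ 4 < \<epsilon>"
        using \<epsilon> by (intro order_tendstoD) auto
      moreover have "\<forall>\<^sub>F t in at s within {s..b}. t \<in> {s..b} \<and> t \<noteq> s" by (simp add: eventually_at_filter)
      ultimately show "\<forall>\<^sub>F t in at s within {s..b}. \<forall>x.
          (bump 4 y (A t) x - bump 4 y (A s) x) / (t - s) \<le> \<psi> x + \<epsilon> * \<eta> x"
      proof eventually_elim
        case (elim t)
        then have t: "0 < t - s" by auto
        show ?case
        proof
          fix x
          show "(bump 4 y (A t) x - bump 4 y (A s) x) / (t - s) \<le> \<psi> x + \<epsilon> * \<eta> x"
          proof (cases "x \<in> cball y R")
            case False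
            then have "bump 4 y (A t) x = 0" "bump 4 y (A s) x = 0" "bump 3 y (A s) x = 0"
              using bump_zero_outside[OF A_le, of _ _ x y] s t R(1) by auto
            then show ?thesis using \<epsilon> \<eta>0[of x] by (simp add: \<psi>_def)
          next
            case True
            have eq: "A t - (x - y) \<bullet> (x - y) = A s - (x - y) \<bullet> (x - y) - c * (t - s)"
              by (simp add: A_def algebra_simps)
            then have "bump 4 y (A t) x \<le> bump 4 y (A s) x - 4 * (c * (t - s)) * bump 3 y (A s) x
                + 6 * (c * (t - s))\<^sup>2 * bump 2 y (A s) x"
              unfolding bump_def eq using c t by (intro pos_part_power4_le) simp
            also have "6 * (c * (t - s))\<^sup>2 * bump 2 y (A s) x \<le> 6 * (c * (t - s))\<^sup>2 * R ^ 4"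
              using bump_le[OF A_le[OF s(1)], of 2 y x] by (intro mult_left_mono) auto
            finally have "bump 4 y (A t) x - bump 4 y (A s) x
                \<le> (t - s) * (\<psi> x + 6 * c\<^sup>2 * (t - s) * R ^ 4)"
              by (simp add: \<psi>_def power2_eq_square algebra_simps)
            then have "(bump 4 y (A t) x - bump 4 y (A s) x) / (t - s) \<le> \<psi> x + 6 * c\<^sup>2 * (t - s) * R ^ 4"
              using t by (simp add: divide_le_eq mult.commute)
            also have "\<dots> \<le> \<psi> x + \<epsilon> * \<eta> x"
              using elim(1) mult_left_mono[OF \<eta>(2)[OF True], of \<epsilon>] \<epsilon> by linarith
            finally show ?thesis .
          qed
        qed
      qed
      show "\<exists>M\<ge>0. \<forall>x. 0 \<le> 1 * \<psi> x + \<epsilon> * \<eta> x + M * bump 4 y (A s) x"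
        unfolding mult_1
      proof (rule nonneg_after_adding_multiple[OF _ _ compact_cball[of y R] _ _ _ _ _ \<epsilon>])
        show "0 \<le> \<psi> x" if "bump 4 y (A s) x = 0" for x
        proof -
          have "bump 3 y (A s) x = 0" using that by (simp add: bump_eq_0_iff)
          then show ?thesis by (simp add: \<psi>_def)
        qed
        show "\<psi> x = 0" if "x \<notin> cball y R" for x
          using bump_zero_outside[OF A_le[OF s(1)] _ _ that] R(1) by (simp add: \<psi>_def)
        show "continuous_on UNIV \<psi>" using \<psi> by (rule C2c_continuous)
      qed (use \<eta> \<eta>0 in \<open>auto intro: continuous_on_bump\<close>)
    next
      have "\<forall>\<^sub>F t in at s within I. (L t (bump 4 y (A s)) - L s (bump 4 y (A s))) / (t - s) \<le> ?r"
        using \<delta> by (intro decay J A_le s) simp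
      then show "\<forall>\<^sub>F t in at s within {s..b}. (L t (bump 4 y (A s)) - L s (bump 4 y (A s))) / (t - s) \<le> ?r"
        using J(1) by (meson at_le filter_leD)
    qed (use J b4 s \<delta> m \<eta> \<psi> in \<open>auto simp: C2c_nonneg_def\<close>)
    moreover have "L s \<psi> = (- 4 * c) * L s (bump 3 y (A s))"
      unfolding \<psi>_def using J b4[OF s(1)] by (intro scale) (auto simp: C2c_nonneg_def)
    moreover have "D * L s (bump 3 y (A s)) \<le> (4 * c) * L s (bump 3 y (A s))"
      using nonneg[OF J(2) b4(2)[OF s(1)]] c by (intro mult_right_mono)
    ultimately have "\<forall>\<^sub>F t in at s within {s..b}. (L t (bump 4 y (A t)) - L s (bump 4 y (A s))) / (t - s) \<le> D + \<delta>"
      by (auto elim!: eventually_mono)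
    then show "\<forall>\<^sub>F t in at_right s. (L t (bump 4 y (A t)) - L s (bump 4 y (A s))) / (t - s) \<le> D + \<delta>"
      using at_within_Icc_at_right[OF s(2)] by simp
  qed
  then show ?thesis by (simp add: A_def)
qed

end

text \<open>
  In time \<open>d\<close> a bump of radius \<open>R\<close> loses at most half of $R^2$, so it still dominates the bump of
  parameter $R^2/2$. Starting the barrier slightly before \<open>s\<close> therefore bounds the mass of small
  balls on both sides of \<open>s\<close>, and finitely many of these balls cover the support of \<open>\<eta>\<close>.
\<close>
lemma (in positive_functionals) locally_bounded:
  assumes I: "I = {t1..t2}" and U: "open U" and s: "s \<in> I" and \<eta>: "\<eta> \<in> C2c_nonneg U"
    and decay: "\<And>y. y \<in> U \<Longrightarrow> \<exists>R D. 0 < R \<and> cball y R \<subseteq> U \<and> 0 \<le> D \<and>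
      (\<forall>s\<in>I. \<forall>A\<le>R\<^sup>2. \<forall>r>D * L s (bump 3 y A) + D.
        \<forall>\<^sub>F t in at s within I. (L t (bump 4 y A) - L s (bump 4 y A)) / (t - s) \<le> r)"
  shows "\<exists>m. \<forall>\<^sub>F t in at s within I. L t \<eta> \<le> m"
proof -
  define P where "P y R D \<longleftrightarrow> 0 < R \<and> cball y R \<subseteq> U \<and> 0 \<le> D \<and>
      (\<forall>s\<in>I. \<forall>A\<le>R\<^sup>2. \<forall>r>D * L s (bump 3 y A) + D.
        \<forall>\<^sub>F t in at s within I. (L t (bump 4 y A) - L s (bump 4 y A)) / (t - s) \<le> r)" for y R D
  have "\<forall>y\<in>U. \<exists>R D. P y R D" unfolding P_def using decay by blast
  then obtain R D where "\<forall>y\<in>U. P y (R y) (D y)" by metis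
  note RD = this[rule_format, unfolded P_def]
  have half: "bump 4 y ((R y)\<^sup>2 / 2) \<in> C2c_nonneg U" if "y \<in> U" for y
    using bump_C2c_nonneg[of "(R y)\<^sup>2 / 2" "R y" y U 1] RD[OF that] by simp
  have small_ball: "\<exists>m. \<forall>\<^sub>F t in at s within I. L t (bump 4 y ((R y)\<^sup>2 / 2)) \<le> m" if y: "y \<in> U" for y
  proof -
    have R: "0 < R y" "cball y (R y) \<subseteq> U" and D: "0 \<le> D y" using RD[OF y] by auto
    \<comment> \<open>the summand 1 keeps \<open>c\<close> positive if \<open>D y = 0\<close>\<close>
    define c where "c = (D y + 1) / 4"
    have c: "0 < c" "D y \<le> 4 * c" using D by (auto simp: c_def)
    define d where "d = (R y)\<^sup>2 / (2 * c)"
    have d: "0 < d" "c * d = (R y)\<^sup>2 / 2" using R c by (auto simp: d_def)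
    \<comment> \<open>every \<open>t \<in> I\<close> within \<open>d / 2\<close> of \<open>s\<close> then satisfies \<open>a \<le> t \<le> a + d\<close>\<close>
    define a where "a = max t1 (s - d / 2)"
    have a: "a \<in> I" using s d by (auto simp: I a_def)
    let ?m = "L a (bump 4 y ((R y)\<^sup>2)) + D y * d"
    have "\<forall>\<^sub>F t in at s within I. t \<in> I \<and> dist t s < d / 2"
      using d by (auto simp: eventually_at intro: exI[of _ "d / 2"])
    then have "\<forall>\<^sub>F t in at s within I. L t (bump 4 y ((R y)\<^sup>2 / 2)) \<le> ?m"
    proof eventually_elim
      case (elim t)
      then have t: "t \<in> I" "a \<le> t" "t - a \<le> d" by (auto simp: a_def I dist_real_def abs_real_def split: if_splits)
      have "c * (t - a) \<le> c * d" "0 \<le> c * (t - a)" using t c by auto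
      then have A: "(R y)\<^sup>2 / 2 \<le> (R y)\<^sup>2 - c * (t - a)" "(R y)\<^sup>2 - c * (t - a) \<le> (R y)\<^sup>2"
        using d by auto
      have "bump 4 y ((R y)\<^sup>2 - c * (t - a)) \<in> C2c U"
        using bump_C2c[OF A(2) _ R(2), of 1] R by simp
      then have "L t (bump 4 y ((R y)\<^sup>2 / 2)) \<le> L t (bump 4 y ((R y)\<^sup>2 - c * (t - a)))"
        using t half[OF y] A by (intro mono bump_mono) (auto simp: C2c_nonneg_def)
      also have "\<dots> \<le> L a (bump 4 y ((R y)\<^sup>2)) + D y * (t - a)"
      proof (rule barrier[OF U R D _ t(2) _ c(2)])
        show "{a..t} \<subseteq> I" using a t by (auto simp: I)
      qed (use RD[OF y] c in auto)
      also have "\<dots> \<le> ?m" using t D by (auto intro: mult_left_mono)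
      finally show ?case .
    qed
    then show ?thesis by blast
  qed
  then obtain m where m: "\<And>y. y \<in> U \<Longrightarrow> \<forall>\<^sub>F t in at s within I. L t (bump 4 y ((R y)\<^sup>2 / 2)) \<le> m y"
    by metis
  let ?K = "support \<eta>"
  have K: "compact ?K" "?K \<subseteq> U" and \<eta>': "\<eta> \<in> C2c U"
    using \<eta> by (auto simp: C2c_nonneg_def C2c_def)
  obtain F c where F: "finite F" "F \<subseteq> ?K" "0 \<le> c" "\<forall>x\<in>?K. 1 \<le> c * (\<Sum>y\<in>F. bump 4 y ((R y)\<^sup>2 / 2) x)"
  proof -
    have "0 < (R y)\<^sup>2 / 2" if "y \<in> ?K" for y
      using RD[of y, THEN conjunct1] that K(2) by (simp add: subset_iff)
    then have "\<exists>F c. finite F \<and> F \<subseteq> ?K \<and> 0 \<le> c \<and>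
        (\<forall>x\<in>?K. 1 \<le> c * (\<Sum>y\<in>F. bump 4 y ((R y)\<^sup>2 / 2) x))"
      by (rule exists_bump_cover[OF K(1)])
    then show ?thesis by (elim exE conjE) (rule that)
  qed
  obtain C where C: "0 \<le> C" "\<And>x. \<bar>\<eta> x\<bar> \<le> C" using C2c_bounded[OF \<eta>'] by blast
  have bF: "bump 4 y ((R y)\<^sup>2 / 2) \<in> C2c U" if "y \<in> F" for y
    using half[of y] that F K by (auto simp: C2c_nonneg_def)
  have dom: "\<eta> x \<le> C * c * (\<Sum>y\<in>F. bump 4 y ((R y)\<^sup>2 / 2) x)" for x
  proof (cases "x \<in> ?K")
    case True
    have "\<eta> x \<le> C * 1" using C(2)[of x] by simp
    also have "\<dots> \<le> C * (c * (\<Sum>y\<in>F. bump 4 y ((R y)\<^sup>2 / 2) x))"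
      using F(4) True C by (intro mult_left_mono) auto
    finally show ?thesis by (simp add: mult.assoc)
  next
    case False
    then have "\<eta> x = 0" using in_support[of \<eta> x] by blast
    then show ?thesis using C F by (auto intro!: mult_nonneg_nonneg sum_nonneg)
  qed
  have "\<forall>\<^sub>F t in at s within I. \<forall>y\<in>F. L t (bump 4 y ((R y)\<^sup>2 / 2)) \<le> m y"
    using F K m by (intro eventually_ball_finite) auto
  moreover have "\<forall>\<^sub>F t in at s within I. t \<in> I" by (simp add: eventually_at_filter)
  ultimately have "\<forall>\<^sub>F t in at s within I. L t \<eta> \<le> C * c * (\<Sum>y\<in>F. m y)"
  proof eventually_elim
    case (elim t)
    have "L t \<eta> \<le> L t (\<lambda>x. (C * c) * (\<Sum>y\<in>F. bump 4 y ((R y)\<^sup>2 / 2) x))"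
      using elim \<eta>' bF dom by (intro mono C2c_scale C2c_sum) auto
    also have "\<dots> = (C * c) * (\<Sum>y\<in>F. L t (bump 4 y ((R y)\<^sup>2 / 2)))"
      using elim bF F by (subst scale) (auto intro: C2c_sum simp: functional_sum)
    also have "\<dots> \<le> (C * c) * (\<Sum>y\<in>F. m y)"
      using elim C F by (intro mult_left_mono sum_mono) auto
    finally show ?case .
  qed
  then show ?thesis by blast
qed

section \<open>Difference quotients along a curve of test functions\<close>

text \<open>
  Each side of \<open>s\<close> is treated separately. Where \<open>\<phi> s\<close> vanishes, the quotients of the nonnegative
  functions \<open>\<phi> t\<close> have the sign of \<open>t - s\<close>, and so has their limit \<open>\<phi>' s\<close>.
\<close>
lemma (in positive_functionals) curve_quotient_le:
  assumes U: "open U" and s: "s \<in> I" and curve: "C1_curve I U \<phi> \<phi>'"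
    and bounded: "\<And>\<eta>. \<eta> \<in> C2c_nonneg U \<Longrightarrow> \<exists>m. \<forall>\<^sub>F t in at s within I. L t \<eta> \<le> m"
    and quotient: "\<forall>\<^sub>F t in at s within I. (L t (\<phi> s) - L s (\<phi> s)) / (t - s) \<le> r"
    and \<delta>: "0 < \<delta>"
  shows "\<forall>\<^sub>F t in at s within I. (L t (\<phi> t) - L s (\<phi> s)) / (t - s) \<le> r + L s (\<phi>' s) + \<delta>"
proof -
  have \<phi>: "\<phi> t \<in> C2c_nonneg U" "\<phi> t \<in> C2c U" if "t \<in> I" for t
    using curve that by (auto simp: C1_curve_def C2c_nonneg_def)
  have \<phi>': "\<phi>' s \<in> C2c U" using curve s by (simp add: C1_curve_def)
  have "\<exists>K. compact K \<and> K \<subseteq> U \<and> (\<forall>t\<in>I. support (\<phi> t) \<subseteq> K)"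
    using curve unfolding C1_curve_def by (elim conjE)
  then obtain K where K: "compact K" "K \<subseteq> U" "\<And>t. t \<in> I \<Longrightarrow> support (\<phi> t) \<subseteq> K"
    by blast
  let ?N = "\<lambda>t x. (\<phi> t x - \<phi> s x) / (t - s) - \<phi>' s x"
  have N: "\<bar>?N t x\<bar> \<le> C2_norm (?N t)" if "t \<in> I" for t x
  proof (rule abs_le_C2_norm)
    have "(\<lambda>x. 1 * ((1 / (t - s)) * \<phi> t x + (- 1 / (t - s)) * \<phi> s x) + (- 1) * \<phi>' s x) \<in> C2c U"
      using \<phi> \<phi>' s that by (intro C2c_add_scale)
    then show "?N t \<in> C2c U" by (simp add: diff_divide_distrib)
  qed
  have N_lim: "((\<lambda>t. C2_norm (?N t)) \<longlongrightarrow> 0) (at s within I)"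
    using curve s by (simp add: C1_curve_def)
  have I_ev: "\<forall>\<^sub>F t in at s within J. t \<in> J" for J by (simp add: eventually_at_filter)
  have pointwise: "((\<lambda>t. (\<phi> t x - \<phi> s x) / (t - s)) \<longlongrightarrow> \<phi>' s x) (at s within I)" for x
  proof (rule Lim_transform[OF tendsto_const])
    have "\<forall>\<^sub>F t in at s within I. norm (?N t x) \<le> C2_norm (?N t)"
      using I_ev[of I] N by (auto elim!: eventually_mono)
    from Lim_null_comparison[OF this N_lim] show "((\<lambda>t. ?N t x) \<longlongrightarrow> 0) (at s within I)" .
  qed
  let ?K = "K \<union> support (\<phi>' s)"
  have K': "compact ?K" "?K \<subseteq> U" using K \<phi>' by (auto simp: C2c_def)
  obtain \<eta> where \<eta>: "\<eta> \<in> C2c_nonneg U" "\<And>x. x \<in> ?K \<Longrightarrow> 1 \<le> \<eta> x"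
    using exists_cutoff[OF U K'] by blast
  have \<eta>0: "0 \<le> \<eta> x" for x using \<eta> by (simp add: C2c_nonneg_def)
  obtain m where m: "\<forall>\<^sub>F t in at s within I. L t \<eta> \<le> m" using bounded[OF \<eta>(1)] by blast
  have side: "\<forall>\<^sub>F t in at s within J. (L t (\<phi> t) - L s (\<phi> s)) / (t - s) \<le> r + L s (\<phi>' s) + \<delta>"
    if J: "J \<subseteq> I" "\<And>t. t \<in> J \<Longrightarrow> 0 \<le> \<sigma> * (t - s)" and \<sigma>: "\<sigma> = 1 \<or> \<sigma> = -1" for J \<sigma>
  proof (cases "at s within J = bot")
    case False
    have le: "at s within J \<le> at s within I" using J(1) by (rule at_le)
    show ?thesis
    proof (rule one_sided_quotient_le[where \<sigma> = \<sigma> and m = m and \<phi> = \<phi>, OF s \<sigma> J \<phi>(1)[OF s] _ \<phi>' \<eta>(1) _ _ _ _ \<delta>])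
      show "\<phi> t \<in> C2c U" if "t \<in> J" for t using \<phi> J that by blast
      show "\<forall>\<^sub>F t in at s within J. L t \<eta> \<le> m" using m le by (rule filter_leD[rotated])
      show "\<forall>\<^sub>F t in at s within J. (L t (\<phi> s) - L s (\<phi> s)) / (t - s) \<le> r"
        using quotient le by (rule filter_leD[rotated])
      fix \<epsilon> :: real assume \<epsilon>: "0 < \<epsilon>"
      have "\<forall>\<^sub>F t in at s within I. C2_norm (?N t) < \<epsilon>" using N_lim \<epsilon> by (rule order_tendstoD)
      then have "\<forall>\<^sub>F t in at s within I. \<forall>x. (\<phi> t x - \<phi> s x) / (t - s) \<le> \<phi>' s x + \<epsilon> * \<eta> x"
        using I_ev[of I]
      proof eventually_elim
        case (elim t)
        show ?case
        proof
          fix x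
          show "(\<phi> t x - \<phi> s x) / (t - s) \<le> \<phi>' s x + \<epsilon> * \<eta> x"
          proof (cases "x \<in> ?K")
            case True
            then show ?thesis
              using N[OF elim(2), of x] elim(1) mult_left_mono[OF \<eta>(2)[OF True], of \<epsilon>] \<epsilon> by linarith
          next
            case False
            then have "\<phi> t x = 0" "\<phi> s x = 0" "\<phi>' s x = 0"
              using in_support[of "\<phi> t" x] in_support[of "\<phi> s" x] in_support[of "\<phi>' s" x] K(3) elim s by blast+
            then show ?thesis using \<epsilon> \<eta>0[of x] by simp
          qed
        qed
      qed
      then show "\<forall>\<^sub>F t in at s within J. \<forall>x. (\<phi> t x - \<phi> s x) / (t - s) \<le> \<phi>' s x + \<epsilon> * \<eta> x"
        using le by (rule filter_leD[rotated])
      show "\<exists>M\<ge>0. \<forall>x. 0 \<le> \<sigma> * \<phi>' s x + \<epsilon> * \<eta> x + M * \<phi> s x"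
      proof (rule nonneg_after_adding_multiple[OF _ _ K'(1) _ \<eta>(2) _ \<eta>0 _ \<epsilon>])
        show "continuous_on UNIV (\<phi> s)" "continuous_on UNIV (\<lambda>x. \<sigma> * \<phi>' s x)"
          by (intro continuous_intros C2c_continuous[OF \<phi>(2)[OF s]] C2c_continuous[OF \<phi>'])+
        show "\<sigma> * \<phi>' s x = 0" if "x \<notin> ?K" for x
        proof -
          have "\<phi>' s x = 0" using that in_support[of "\<phi>' s" x] by blast
          then show ?thesis by simp
        qed
        show "0 \<le> \<phi> s x" for x using \<phi>(1)[OF s] by (simp add: C2c_nonneg_def)
        show "0 \<le> \<sigma> * \<phi>' s x" if zero: "\<phi> s x = 0" for x
        proof (rule tendsto_lowerbound[OF _ _ False])
          show "((\<lambda>t. \<sigma> * ((\<phi> t x - \<phi> s x) / (t - s))) \<longlongrightarrow> \<sigma> * \<phi>' s x) (at s within J)"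
            by (intro tendsto_mult tendsto_const tendsto_mono[OF le pointwise])
          show "\<forall>\<^sub>F t in at s within J. 0 \<le> \<sigma> * ((\<phi> t x - \<phi> s x) / (t - s))"
            using I_ev[of J]
          proof eventually_elim
            case (elim t)
            have "0 \<le> \<phi> t x" using \<phi>(1)[of t] J(1) elim by (auto simp: C2c_nonneg_def)
            then show ?case
              using J(2)[OF elim] \<sigma> zero by (auto simp: divide_nonneg_nonneg divide_nonneg_nonpos)
          qed
        qed
      qed
    qed
  qed simp
  have "I = (I \<inter> {s..}) \<union> (I \<inter> {..s})" by auto
  then have "at s within I = sup (at s within I \<inter> {s..}) (at s within I \<inter> {..s})"
    by (metis at_within_union)
  moreover have "\<forall>\<^sub>F t in at s within I \<inter> {s..}. (L t (\<phi> t) - L s (\<phi> s)) / (t - s) \<le> r + L s (\<phi>' s) + \<delta>"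
    by (rule side[of _ 1]) auto
  moreover have "\<forall>\<^sub>F t in at s within I \<inter> {..s}. (L t (\<phi> t) - L s (\<phi> s)) / (t - s) \<le> r + L s (\<phi>' s) + \<delta>"
    by (rule side[of _ "- 1"]) auto
  ultimately show ?thesis by (simp add: eventually_sup)
qed

section \<open>Differentiation along moving test functions\<close>

lemma eventually_quotient_le_if_upper_derivative_less:
  assumes "upper_derivative I f s < ereal r"
  shows "\<forall>\<^sub>F t in at s within I. (f t - f s) / (t - s) \<le> r"
proof -
  have "\<forall>\<^sub>F t in at s within I. ereal ((f t - f s) / (t - s)) < ereal r"
    using assms unfolding upper_derivative_def by (rule Limsup_lessD)
  then show ?thesis by (auto elim!: eventually_mono)
qed

lemma weight_positive_functionals:
  assumes V: "\<And>t. t \<in> I \<Longrightarrow> V t \<in> varifolds n U"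
    and finite: "\<And>s \<phi>. s \<in> I \<Longrightarrow> \<phi> \<in> C2c_nonneg U \<Longrightarrow>
      upper_derivative I (\<lambda>t. \<integral>x. \<phi> x \<partial>weight U (V t)) s < \<infinity>"
  shows "positive_functionals I U (\<lambda>t \<phi>. \<integral>x. \<phi> x \<partial>weight U (V t))"
proof
  have int: "integrable (weight U (V t)) \<phi>" if t: "t \<in> I" and \<phi>: "\<phi> \<in> C2c U" for t \<phi>
  proof -
    obtain C where C: "\<And>x. \<bar>\<phi> x\<bar> \<le> C" using C2c_bounded[OF \<phi>] by blast
    show ?thesis
    proof (rule integrable_weight[OF V[OF t], of "support \<phi>"])
      show "\<phi> \<in> borel_measurable borel"
        by (intro borel_measurable_continuous_onI C2c_continuous[OF \<phi>])
      show "\<phi> x = 0" if "x \<notin> support \<phi>" for x using that in_support[of \<phi> x] by blast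
    qed (use \<phi> C in \<open>auto simp: C2c_def\<close>)
  qed
  show "(\<integral>x. a * \<phi> x + b * \<psi> x \<partial>weight U (V t)) = a * (\<integral>x. \<phi> x \<partial>weight U (V t)) + b * (\<integral>x. \<psi> x \<partial>weight U (V t))"
    if "t \<in> I" "\<phi> \<in> C2c U" "\<psi> \<in> C2c U" for t \<phi> \<psi> a b
    using int that by simp
  show "(\<integral>x. \<phi> x \<partial>weight U (V t)) \<le> (\<integral>x. \<psi> x \<partial>weight U (V t))"
    if "t \<in> I" "\<phi> \<in> C2c U" "\<psi> \<in> C2c U" "\<And>x. \<phi> x \<le> \<psi> x" for t \<phi> \<psi>
    using int that by (intro integral_mono) auto
  show "\<exists>C. \<forall>\<^sub>F t in at s within I. ((\<integral>x. \<phi> x \<partial>weight U (V t)) - (\<integral>x. \<phi> x \<partial>weight U (V s))) / (t - s) \<le> C"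
    if s: "s \<in> I" and \<phi>: "\<phi> \<in> C2c_nonneg U" for s \<phi>
  proof -
    obtain C where "upper_derivative I (\<lambda>t. \<integral>x. \<phi> x \<partial>weight U (V t)) s < ereal C"
      using ereal_dense2[OF finite[OF s \<phi>]] by blast
    then show ?thesis by (blast dest: eventually_quotient_le_if_upper_derivative_less)
  qed
qed

theorem proposition4p6:
  fixes n k :: nat
    and U :: "(real ^ 'd::finite) set"
    and t1 t2 :: real
    and V :: "real \<Rightarrow> ((real ^ 'd) \<times> (real ^ 'd) set) measure"
    and B :: "((real ^ 'd) \<times> (real ^ 'd) set) measure \<Rightarrow> (real ^ 'd \<Rightarrow> real) \<Rightarrow>
      (real ^ 'd \<Rightarrow> real ^ 'd) \<Rightarrow> ereal"
    and u :: "real \<Rightarrow> real ^ 'd \<Rightarrow> real ^ 'd"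
  assumes "1 \<le> n" and "1 \<le> k" and "CARD('d) = n + k"
    and "open U" and "t1 < t2"
    and "\<forall>t\<in>{t1..t2}. V t \<in> varifolds n U"
    and "\<forall>W\<in>varifolds n U. \<forall>\<phi>\<in>C2c U. \<forall>f\<in>extensional U. B W \<phi> f < \<infinity>"
    and "brakke_variation n U B"
    and "\<forall>t\<in>{t1..t2}. u t \<in> extensional U"
    and "(\<forall>K\<in>sets borel. relatively_compact_in K U \<longrightarrow>
            (SUP t\<in>{t1..t2}. Linf_norm (weight U (V t)) K (u t)) < \<infinity>) \<or>
         (\<forall>K\<in>sets borel. relatively_compact_in K U \<longrightarrow>
            (SUP t\<in>{t1..t2}. L2_norm (weight U (V t)) K (u t)) < \<infinity>)"
    and B1: "\<forall>s\<in>{t1..t2}. \<forall>\<phi>\<in>C2c_nonneg U.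
      upper_derivative {t1..t2} (\<lambda>t. \<integral>x. \<phi> x \<partial>weight U (V t)) s \<le> B (V s) \<phi> (u s)"
  shows "\<forall>s\<in>{t1..t2}. \<forall>\<phi> \<phi>'. C1_curve {t1..t2} U \<phi> \<phi>' \<longrightarrow>
      upper_derivative {t1..t2} (\<lambda>t. \<integral>x. \<phi> t x \<partial>weight U (V t)) s
        \<le> B (V s) (\<phi> s) (u s) + ereal (\<integral>x. \<phi>' s x \<partial>weight U (V s))"
proof (intro ballI allI impI)
  let ?I = "{t1..t2}" and ?L = "\<lambda>t \<phi>. \<integral>x. \<phi> x \<partial>weight U (V t)"
  fix s \<phi> \<phi>' assume s: "s \<in> ?I" and curve: "C1_curve ?I U \<phi> \<phi>'"
  have B_finite: "B (V t) \<psi> (u t) < \<infinity>" if "t \<in> ?I" "\<psi> \<in> C2c_nonneg U" for t \<psi>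
    using assms(6,7,9) that by (auto simp: C2c_nonneg_def)
  interpret positive_functionals ?I U ?L
  proof (rule weight_positive_functionals[where n = n])
    show "upper_derivative ?I (\<lambda>t. ?L t \<psi>) \<tau> < \<infinity>" if "\<tau> \<in> ?I" "\<psi> \<in> C2c_nonneg U" for \<tau> \<psi>
      using B1[rule_format, OF that] B_finite[OF that] by (rule le_less_trans)
  qed (use assms(6) in blast)
  have decay: "\<exists>R D. 0 < R \<and> cball y R \<subseteq> U \<and> 0 \<le> D \<and>
      (\<forall>s\<in>?I. \<forall>A\<le>R\<^sup>2. \<forall>r>D * ?L s (bump 3 y A) + D.
        \<forall>\<^sub>F t in at s within ?I. (?L t (bump 4 y A) - ?L s (bump 4 y A)) / (t - s) \<le> r)"
    if y: "y \<in> U" for y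
  proof -
    obtain R where R: "0 < R" "cball y R \<subseteq> U"
      using assms(4) y open_contains_cball by blast
    obtain D where D: "0 \<le> D" "\<And>t A. t \<in> ?I \<Longrightarrow> A \<le> R\<^sup>2 \<Longrightarrow>
        B (V t) (bump 4 y A) (u t) \<le> ereal (D * ?L t (bump 3 y A) + D)"
      using brakke_variation_bump_uniform_bound[OF assms(8,6,9,10) less_imp_le[OF R(1)] R(2)] by blast
    have "\<forall>\<^sub>F t in at s within ?I. (?L t (bump 4 y A) - ?L s (bump 4 y A)) / (t - s) \<le> r"
      if "s \<in> ?I" "A \<le> R\<^sup>2" "D * ?L s (bump 3 y A) + D < r" for s A r
    proof (rule eventually_quotient_le_if_upper_derivative_less)
      have "bump 4 y A \<in> C2c_nonneg U"
        using bump_C2c_nonneg[OF that(2) _ R(2), of 1] R by simp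
      then have "upper_derivative ?I (\<lambda>t. ?L t (bump 4 y A)) s \<le> B (V s) (bump 4 y A) (u s)"
        using B1 that(1) by blast
      also have "\<dots> \<le> ereal (D * ?L s (bump 3 y A) + D)" using D(2) that by blast
      also have "\<dots> < ereal r" using that by simp
      finally show "upper_derivative ?I (\<lambda>t. ?L t (bump 4 y A)) s < ereal r" .
    qed
    then show ?thesis using R D(1) by blast
  qed
  have bounded: "\<exists>m. \<forall>\<^sub>F t in at s within ?I. ?L t \<eta> \<le> m" if "\<eta> \<in> C2c_nonneg U" for \<eta>
    using locally_bounded[OF refl assms(4) s that decay] by blast
  have \<phi>s: "\<phi> s \<in> C2c_nonneg U" using curve s by (simp add: C1_curve_def)
  let ?b = "B (V s) (\<phi> s) (u s)" and ?l = "?L s (\<phi>' s)"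
  show "upper_derivative ?I (\<lambda>t. ?L t (\<phi> t)) s \<le> ?b + ereal ?l"
    unfolding upper_derivative_def Limsup_le_iff
  proof (intro allI impI)
    fix z assume z: "?b + ereal ?l < z"
    obtain w where w: "?b + ereal ?l < ereal w" "ereal w < z" using ereal_dense2[OF z] by blast
    \<comment> \<open>\<open>r\<close> lies strictly above \<open>?b\<close>, and \<open>w - ?l - r\<close> is the slack in the quotient estimate\<close>
    have "?b < ereal (w - ?l)" using w(1) B_finite[OF s \<phi>s] by (cases ?b) auto
    then obtain r where r: "?b < ereal r" "ereal r < ereal (w - ?l)" using ereal_dense2 by blast
    have "upper_derivative ?I (\<lambda>t. ?L t (\<phi> s)) s < ereal r"
      using B1 s \<phi>s r(1) by (meson le_less_trans)
    then have q: "\<forall>\<^sub>F t in at s within ?I. (?L t (\<phi> s) - ?L s (\<phi> s)) / (t - s) \<le> r"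
      by (rule eventually_quotient_le_if_upper_derivative_less)
    have "\<forall>\<^sub>F t in at s within ?I. (?L t (\<phi> t) - ?L s (\<phi> s)) / (t - s) \<le> r + ?l + (w - ?l - r)"
      using r(2) by (intro curve_quotient_le[OF assms(4) s curve bounded q]) auto
    then show "\<forall>\<^sub>F t in at s within ?I. ereal ((?L t (\<phi> t) - ?L s (\<phi> s)) / (t - s)) < z"
    proof eventually_elim
      case (elim t)
      then have "ereal ((?L t (\<phi> t) - ?L s (\<phi> s)) / (t - s)) \<le> ereal w" by simp
      then show ?case using w(2) by (rule le_less_trans)
    qed
  qed
qed

end
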